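(* Let $R$ be a two-dimensional regular local ring with maximal ideal $\mathfrak{m}$, and let $\mathcal{S}=\{\nu_i\}_{i\in I}$ be any non-empty set of centered valuations $\nu_i:R\to\mathbb{R}_\infty$ normalized by $\nu_i(\mathfrak{m})=1$. Then there exists a valuation $\nu:R\to\mathbb{R}_\infty$ (a centered valuation with $\nu(\mathfrak{m})=1$) which is the infimum of $\mathcal{S}$, in the set of all centered valuations $R\to\mathbb{R}_\infty$ normalized by $1$, with respect to the partial order given by $\nu\leq\mu$ if and only if $\nu(\phi)\leq\mu(\phi)$ for every $\phi\in R$.
   Context: Write $\mathbb{R}_\infty=\mathbb{R}\cup\{\infty\}$, with the usual extension of addition and order to $\infty$. A valuation on a commutative ring $R$ with values in $\mathbb{R}_\infty$ is a non-constant map $\nu:R\to\mathbb{R}_\infty$ such that $\nu(\phi\psi)=\nu(\phi)+\nu(\psi)$ and $\nu(\phi+\psi)\geq\min\{\nu(\phi),\nu(\psi)\}$ for all $\phi,\psi\in R$, and $\nu(1)=0$, $\nu(0)=\infty$. Note that $\nu^{-1}(\infty)$ is a prime ideal which is allowed to be non-zero. If $R$ is a Noetherian local ring with maximal ideal $\mathfrak{m}$, a valuation $\nu$ is centered if $\nu(\phi)\geq 0$ for all $\phi\in R$ and $\nu(\phi)>0$ for all $\phi\in\mathfrak{m}$; in this case $\nu(\mathfrak{m}):=\min\{\nu(\phi)\mid\phi\in\mathfrak{m}\}$. The valuation is normalized by $1$ if $\nu(\mathfrak{m})=1$. *)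

theory Defs
  imports
    "HOL-Algebra.Ring_Divisibility"
    "HOL-Algebra.Order"
    "HOL-Library.Extended_Nat"
    "HOL-Library.Extended_Real"
    "HOL-Library.FuncSet"
begin

text \<open>The length of a chain of primes is its number of strict inclusions. The zero ring, which has
  no prime ideals, gets dimension \<open>0\<close>; this plays no role for local rings.\<close>

definition krull_dim :: "('a, 'b) ring_scheme \<Rightarrow> enat" where
  "krull_dim R = Sup {enat n | n. \<exists>P :: nat \<Rightarrow> 'a set.
     (\<forall>i\<le>n. primeideal (P i) R) \<and> (\<forall>i<n. P i \<subset> P (Suc i))}"

locale local_ring = cring R + maximalideal \<mm> R for \<mm> and R (structure) +
  assumes unique_maximalideal: "maximalideal J R \<Longrightarrow> J = \<mm>"

locale noetherian_local_ring = local_ring \<mm> R + noetherian_ring R for \<mm> and R (structure)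

locale regular_local_ring = noetherian_local_ring \<mm> R for \<mm> and R (structure) +
  assumes regular: "\<exists>A \<subseteq> carrier R. finite A \<and> enat (card A) = krull_dim R \<and> \<mm> = Idl A"

text \<open>\<open>\<real> \<union> {\<infinity>}\<close> is \<^typ>\<open>ereal\<close> without \<open>-\<infinity>\<close>. Valuations are taken to be extensional (\<open>undefined\<close>
  outside the carrier), so that they correspond exactly to functions on the ring and the pointwise
  order on them is antisymmetric.\<close>

locale valuation = cring R for R :: "('a, 'b) ring_scheme" (structure) +
  fixes \<nu> :: "'a \<Rightarrow> ereal"
  assumes val_funcset: "\<nu> \<in> carrier R \<rightarrow>\<^sub>E (- {- \<infinity>})"
    and val_nonconst: "\<exists>\<phi> \<in> carrier R. \<exists>\<psi> \<in> carrier R. \<nu> \<phi> \<noteq> \<nu> \<psi>"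
    and val_mult: "\<lbrakk>\<phi> \<in> carrier R; \<psi> \<in> carrier R\<rbrakk> \<Longrightarrow> \<nu> (\<phi> \<otimes> \<psi>) = \<nu> \<phi> + \<nu> \<psi>"
    and val_add: "\<lbrakk>\<phi> \<in> carrier R; \<psi> \<in> carrier R\<rbrakk> \<Longrightarrow> min (\<nu> \<phi>) (\<nu> \<psi>) \<le> \<nu> (\<phi> \<oplus> \<psi>)"
    and val_one: "\<nu> \<one> = 0"
    and val_zero: "\<nu> \<zero> = \<infinity>"

locale centered_valuation = noetherian_local_ring \<mm> R + valuation R \<nu>
  for \<mm> and R (structure) and \<nu> +
  assumes val_nonneg: "\<phi> \<in> carrier R \<Longrightarrow> 0 \<le> \<nu> \<phi>"
    and val_pos: "\<phi> \<in> \<mm> \<Longrightarrow> 0 < \<nu> \<phi>"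

text \<open>The minimum of \<open>\<nu>\<close> on \<open>I\<close>; for a centered valuation on a Noetherian local ring and its
  maximal ideal it is attained, see \<open>val_ideal_attained\<close> below.\<close>

definition val_ideal :: "('a \<Rightarrow> ereal) \<Rightarrow> 'a set \<Rightarrow> ereal" where
  "val_ideal \<nu> I = (LEAST v. v \<in> \<nu> ` I)"

definition normalized_valuations :: "('a, 'b) ring_scheme \<Rightarrow> 'a set \<Rightarrow> ('a \<Rightarrow> ereal) set" where
  "normalized_valuations R \<mm> = {\<nu>. centered_valuation \<mm> R \<nu> \<and> val_ideal \<nu> \<mm> = 1}"

definition valuation_order :: "('a, 'b) ring_scheme \<Rightarrow> 'a set \<Rightarrow> ('a \<Rightarrow> ereal) gorder" where
  "valuation_order R \<mm> =
     \<lparr>carrier = normalized_valuations R \<mm>, eq = (=), le = (\<lambda>\<nu> \<mu>. \<forall>\<phi> \<in> carrier R. \<nu> \<phi> \<le> \<mu> \<phi>)\<rparr>"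

lemma valuation_order_partial_order: "partial_order (valuation_order R \<mm>)"
proof
  fix \<nu> \<mu>
  assume le: "\<nu> \<sqsubseteq>\<^bsub>valuation_order R \<mm>\<^esub> \<mu>" "\<mu> \<sqsubseteq>\<^bsub>valuation_order R \<mm>\<^esub> \<nu>"
    and carr: "\<nu> \<in> carrier (valuation_order R \<mm>)" "\<mu> \<in> carrier (valuation_order R \<mm>)"
  have "\<nu> \<in> carrier R \<rightarrow>\<^sub>E - {- \<infinity>}" "\<mu> \<in> carrier R \<rightarrow>\<^sub>E - {- \<infinity>}"
    using carr by (auto simp only: valuation_order_def normalized_valuations_def gorder.simps
      partial_object.simps mem_Collect_eq centered_valuation_def valuation_def valuation_axioms_def)
  then have "\<nu> = \<mu>"
    using le by (intro PiE_ext) (auto simp: valuation_order_def intro: antisym)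
  then show "\<nu> .=\<^bsub>valuation_order R \<mm>\<^esub> \<mu>"
    by (simp add: valuation_order_def)
qed (auto simp: valuation_order_def intro: order_trans)

lemma (in centered_valuation) val_ideal_attained:
  "\<exists>\<phi> \<in> \<mm>. val_ideal \<nu> \<mm> = \<nu> \<phi> \<and> (\<forall>\<psi> \<in> \<mm>. \<nu> \<phi> \<le> \<nu> \<psi>)"
proof -
  have "ideal \<mm> R" by (rule is_ideal)
  then obtain A where A: "A \<subseteq> carrier R" "finite A" "\<mm> = Idl A"
    using finetely_gen by blast
  have Asub: "A \<subseteq> \<mm>" using A genideal_self by blast
  have zero_mem: "\<zero> \<in> \<mm>"
    by (simp add: additive_subgroup.zero_closed additive_subgroup_axioms)
  define v where "v = Min (insert \<infinity> (\<nu> ` A))"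
  define J where "J = {\<psi> \<in> carrier R. v \<le> \<nu> \<psi>}"
  have mult_le: "v \<le> \<nu> (\<phi> \<otimes> \<psi>)" if "\<phi> \<in> carrier R" "\<psi> \<in> J" for \<phi> \<psi>
  proof -
    have "v \<le> \<nu> \<psi>" "\<psi> \<in> carrier R" using that by (auto simp: J_def)
    then show ?thesis
      using that val_nonneg[of \<phi>] add_increasing[of "\<nu> \<phi>" v "\<nu> \<psi>"] by (simp add: val_mult)
  qed
  have add_J: "\<phi> \<oplus> \<psi> \<in> J" if "\<phi> \<in> J" "\<psi> \<in> J" for \<phi> \<psi>
    using that val_add[of \<phi> \<psi>] by (auto simp: J_def intro: order_trans[rotated])
  have minus_J: "\<ominus> \<phi> \<in> J" if "\<phi> \<in> J" for \<phi>
  proof -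
    have "\<phi> \<in> carrier R" using that by (simp add: J_def)
    then show ?thesis
      using mult_le[of "\<ominus> \<one>" \<phi>] that by (simp add: J_def l_minus)
  qed
  have "ideal J R"
  proof (rule idealI)
    show "ring R" by (rule ring_axioms)
    show "subgroup J (add_monoid R)"
    proof
      show "J \<subseteq> carrier (add_monoid R)" by (auto simp: J_def)
      show "\<one>\<^bsub>add_monoid R\<^esub> \<in> J" by (simp add: J_def val_zero)
      show "x \<otimes>\<^bsub>add_monoid R\<^esub> y \<in> J" if "x \<in> J" "y \<in> J" for x y
        using add_J[OF that] by simp
      show "inv\<^bsub>add_monoid R\<^esub> x \<in> J" if "x \<in> J" for x
        using minus_J[OF that] by (simp add: a_inv_def)
    qed
    show "x \<otimes> a \<in> J" if "a \<in> J" "x \<in> carrier R" for a x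
      using that mult_le[of x a] by (simp add: J_def)
    show "a \<otimes> x \<in> J" if "a \<in> J" "x \<in> carrier R" for a x
      using that mult_le[of x a] by (simp add: J_def m_comm)
  qed
  moreover have "A \<subseteq> J" using A by (auto simp: J_def v_def)
  ultimately have "\<mm> \<subseteq> J" unfolding A(3) by (rule genideal_minimal)
  then have low: "\<forall>\<psi> \<in> \<mm>. v \<le> \<nu> \<psi>" by (auto simp: J_def)
  have "v \<in> insert \<infinity> (\<nu> ` A)" unfolding v_def using A(2) by (intro Min_in) auto
  then obtain \<phi> where \<phi>: "\<phi> \<in> \<mm>" "\<nu> \<phi> = v"
    using Asub zero_mem val_zero by (metis image_iff insert_iff subsetD)
  have "val_ideal \<nu> \<mm> = v"
    unfolding val_ideal_def using \<phi> low by (intro Least_equality) auto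
  then show ?thesis using \<phi> low by metis
qed

end

theory Submission
  imports Defs
begin

text \<open>
The infimum of \<open>S\<close> is the pointwise supremum of the normalized valuations that lie below every
member of \<open>S\<close>. A pointwise supremum of valuations need not be multiplicative, but the
supremum of a chain is: two members that are nearly optimal at \<open>f\<close> and at \<open>g\<close>
can then be replaced by the larger of the two (\<open>chain_Sup_normalized\<close>). Being bounded by a
member of \<open>S\<close> keeps the value of the maximal ideal equal to \<open>1\<close>. So two things
have to be shown: the set of lower bounds is not empty, and it is a chain.

It is not empty because it contains the \<open>\<mm>\<close>-adic order (\<open>max_order_normalized\<close>,
\<open>max_order_le\<close>). The order is multiplicative because the associated graded ring of a regular
local ring is a domain. The proof here is concrete. With \<open>\<mm> = (x, y)\<close>, multiplication by
\<open>x\<close> is injective on the associated graded ring (\<open>x_cancel_max_power\<close>), so a leading form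
can be divided by its power of \<open>x\<close>, and the quotients are visible modulo \<open>x\<close>
(\<open>leading_form\<close>).

It is a chain because the normalized valuations are ordered like a tree: if \<open>\<mu>\<^sub>1\<close> and
\<open>\<mu>\<^sub>2\<close> both lie below \<open>\<nu>\<close>, they are comparable. For valuations on a polynomial
ring \<open>K[y]\<close> that agree on \<open>K\<close>, one would take a monic \<open>\<phi>\<close> of least degree on
which \<open>\<mu>\<^sub>1\<close> or \<open>\<mu>\<^sub>2\<close> falls short of \<open>\<nu>\<close>. By symmetry let
\<open>\<mu>\<^sub>1 \<phi> \<le> \<mu>\<^sub>2 \<phi>\<close>, so that \<open>\<mu>\<^sub>1 \<phi> < \<nu> \<phi>\<close>, and divide
with remainder by \<open>\<phi>\<close>. On remainders the three valuations agree. A remainder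
cannot cancel against the multiple of \<open>\<phi>\<close> for \<open>\<mu>\<^sub>1\<close>, since otherwise
\<open>\<nu>\<close> would see the cancellation too although it gives the multiple of \<open>\<phi>\<close> a strictly
larger value. So \<open>\<mu>\<^sub>1 f \<le> \<mu>\<^sub>2 f\<close> follows from the same inequality at the
quotient. In the local ring this descent ends because the value of the quotient is smaller by at least
\<open>1\<close> (\<open>valuation_le_if_approx_division\<close>).

In the local ring, degrees are replaced as follows. Choose \<open>x \<in> \<mm>\<close> with
\<open>\<nu> x = 1\<close>. All normalized valuations below \<open>\<nu>\<close> then also give \<open>x\<close> the value
\<open>1\<close>, and \<open>x\<close> can be completed to a generating pair \<open>x, y\<close> of \<open>\<mm>\<close>. The
quotient by \<open>x\<close> is a discrete valuation ring with uniformizer \<open>y\<close>, and the order of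
\<open>\<phi>\<close> in it plays the role of the degree. The usual Weierstrass division then produces,
without any completeness, a remainder that is either regular of smaller order up to a power of
\<open>x\<close> or divisible by an arbitrarily high power of \<open>x\<close> (\<open>approx_division\<close>).
The latter has large value, so it does not disturb the argument.

Dimension two enters through Krull's principal ideal theorem: no power of \<open>y\<close> is a multiple of
\<open>x\<close>, and \<open>R\<close> is a domain. Both are derived from a chain of primes \<open>P0 \<subset> P1 \<subset> \<mm>\<close>
(\<open>prime_chain_imp_pow_notin\<close>, \<open>domain_if_prime_chain\<close>).
\<close>

section \<open>Local rings and Nakayama's lemma\<close>

lemma (in noetherian_ring) maximal_ideal_of_family:
  assumes "F \<noteq> {}" "\<And>I. I \<in> F \<Longrightarrow> ideal I R"
  shows "\<exists>M\<in>F. \<forall>I\<in>F. M \<subseteq> I \<longrightarrow> I = M"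
proof (rule subset_Zorn)
  fix C assume C: "subset.chain F C"
  show "\<exists>U\<in>F. \<forall>I\<in>C. I \<subseteq> U"
  proof (cases "C = {}")
    case True
    then show ?thesis using assms(1) by auto
  next
    case False
    have "subset.chain {I. ideal I R} C"
      using C assms(2) unfolding pred_on.chain_def by auto
    then have "\<Union>C \<in> C" using False by (rule ideal_chain_is_trivial[rotated])
    then show ?thesis using C unfolding pred_on.chain_def by (meson Union_upper subsetD)
  qed
qed

lemma (in ideal) mem_if_unit_mult_mem:
  assumes "u \<in> Units R" "j \<in> carrier R" "u \<otimes> j \<in> I"
  shows "j \<in> I"
proof -
  have "inv u \<otimes> (u \<otimes> j) \<in> I" using assms I_l_closed by blast
  moreover have "inv u \<otimes> (u \<otimes> j) = j"
    using assms(1,2) by (simp add: m_assoc[symmetric] Units_closed)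
  ultimately show ?thesis by simp
qed

lemma (in primeideal) mem_if_pow_mem:
  fixes k :: nat
  assumes "z [^] k \<in> I" "z \<in> carrier R"
  shows "z \<in> I"
  using assms(1)
proof (induction k)
  case 0
  then show ?case using one_imp_carrier I_notcarr by simp
next
  case (Suc k)
  then show ?case using I_prime[of "z [^] k" z] assms(2) by auto
qed

context noetherian_local_ring
begin

lemma proper_ideal_subset_max:
  assumes "ideal I R" "\<one> \<notin> I"
  shows "I \<subseteq> \<mm>"
proof -
  define F where "F = {J. ideal J R \<and> I \<subseteq> J \<and> \<one> \<notin> J}"
  have "\<exists>M\<in>F. \<forall>J\<in>F. M \<subseteq> J \<longrightarrow> J = M"
    by (rule maximal_ideal_of_family) (use assms in \<open>auto simp: F_def\<close>)
  then obtain M where M: "M \<in> F" "\<And>J. J \<in> F \<Longrightarrow> M \<subseteq> J \<Longrightarrow> J = M" by blast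
  have "maximalideal M R"
  proof (rule maximalidealI)
    show "ideal M R" "carrier R \<noteq> M" using M(1) by (auto simp: F_def)
    show "J = M \<or> J = carrier R" if "ideal J R" "M \<subseteq> J" "J \<subseteq> carrier R" for J
    proof (cases "\<one> \<in> J")
      case True
      then show ?thesis using ideal.one_imp_carrier[OF that(1)] by simp
    next
      case False
      then show ?thesis using that M(1) M(2)[of J] by (auto simp: F_def)
    qed
  qed
  then have "M = \<mm>" by (rule unique_maximalideal)
  then show ?thesis using M(1) by (auto simp: F_def)
qed

lemma one_notin_max: "\<one> \<notin> \<mm>"
  using one_imp_carrier I_notcarr by auto

lemma unit_if_notin_max:
  assumes "a \<in> carrier R" "a \<notin> \<mm>"
  shows "a \<in> Units R"
proof (rule ccontr)
  assume nu: "a \<notin> Units R"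
  have "\<one> \<notin> PIdl a"
  proof
    assume "\<one> \<in> PIdl a"
    then obtain b where "b \<in> carrier R" "\<one> = b \<otimes> a" by (auto simp: cgenideal_def)
    then have "a \<in> Units R" using assms(1) m_comm by (auto simp: Units_def)
    with nu show False ..
  qed
  then have "PIdl a \<subseteq> \<mm>"
    using assms(1) by (intro proper_ideal_subset_max cgenideal_ideal)
  then show False using assms cgenideal_self by blast
qed

lemma unit_notin_max: "u \<in> Units R \<Longrightarrow> u \<notin> \<mm>"
  using I_l_closed[of u "inv u"] one_notin_max by force

lemma one_minus_unit:
  assumes "z \<in> \<mm>"
  shows "\<one> \<ominus> z \<in> Units R"
proof (rule unit_if_notin_max)
  have z: "z \<in> carrier R" using assms by (rule Icarr)
  show "\<one> \<ominus> z \<in> carrier R" using z by simp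
  show "\<one> \<ominus> z \<notin> \<mm>"
  proof
    assume "\<one> \<ominus> z \<in> \<mm>"
    then have "(\<one> \<ominus> z) \<oplus> z \<in> \<mm>" using assms by (rule a_closed)
    then show False using z one_notin_max by (simp add: a_assoc minus_eq l_neg)
  qed
qed

text \<open>Nakayama's lemma for \<open>J \<subseteq> I + z J\<close>, where \<open>J\<close> may be any subset. Among the ideals
\<open>I + (j)\<close> that contain a given \<open>f \<in> J\<close> take a maximal one. Writing \<open>j = i + z k\<close> gives
\<open>I + (j) \<subseteq> I + (k)\<close>, hence equality, so \<open>k\<close> is itself a multiple of \<open>j\<close> modulo
\<open>I\<close> and \<open>(1 - z r) j \<in> I\<close> for some \<open>r\<close>.\<close>

lemma principal_nakayama:
  assumes "ideal I R" "z \<in> \<mm>" "J \<subseteq> carrier R"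
    and step: "\<And>j. j \<in> J \<Longrightarrow> \<exists>j'\<in>J. j \<ominus> z \<otimes> j' \<in> I"
  shows "J \<subseteq> I"
proof
  fix f assume f: "f \<in> J"
  interpret I: ideal I R by fact
  have z: "z \<in> carrier R" using assms(2) by (rule Icarr)
  define F where "F = {I <+>\<^bsub>R\<^esub> PIdl j | j. j \<in> J \<and> f \<in> I <+>\<^bsub>R\<^esub> PIdl j}"
  have mem: "g \<in> I <+>\<^bsub>R\<^esub> PIdl j \<longleftrightarrow> (\<exists>i\<in>I. \<exists>r\<in>carrier R. g = i \<oplus> r \<otimes> j)" for g j
    by (auto simp: set_add_def' cgenideal_def)
  have self: "j \<in> I <+>\<^bsub>R\<^esub> PIdl j" if "j \<in> J" for j
    unfolding mem using that assms(3) I.zero_closed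
    by (intro bexI[of _ \<zero>] bexI[of _ \<one>]) auto
  have "\<exists>M\<in>F. \<forall>I\<in>F. M \<subseteq> I \<longrightarrow> I = M"
  proof (rule maximal_ideal_of_family)
    show "F \<noteq> {}" using f self by (auto simp: F_def)
    show "ideal K R" if "K \<in> F" for K
      using that assms(3) by (auto simp: F_def intro!: add_ideals assms(1) cgenideal_ideal)
  qed
  then obtain M where M: "M \<in> F" "\<And>K. K \<in> F \<Longrightarrow> M \<subseteq> K \<Longrightarrow> K = M" by blast
  then obtain j where j: "j \<in> J" "M = I <+>\<^bsub>R\<^esub> PIdl j" "f \<in> M" by (auto simp: F_def)
  obtain k where k: "k \<in> J" "j \<ominus> z \<otimes> k \<in> I" using step j(1) by blast
  have jc: "j \<in> carrier R" and kc: "k \<in> carrier R" using j k assms(3) by auto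
  have "M \<subseteq> I <+>\<^bsub>R\<^esub> PIdl k"
  proof
    fix g assume "g \<in> M"
    then obtain i r where g: "i \<in> I" "r \<in> carrier R" "g = i \<oplus> r \<otimes> j"
      unfolding j(2) mem by blast
    have "g = (i \<oplus> r \<otimes> (j \<ominus> z \<otimes> k)) \<oplus> (r \<otimes> z) \<otimes> k"
      using g jc kc z I.Icarr by algebra
    moreover have "i \<oplus> r \<otimes> (j \<ominus> z \<otimes> k) \<in> I" using g k I.I_l_closed I.a_closed by blast
    ultimately show "g \<in> I <+>\<^bsub>R\<^esub> PIdl k" unfolding mem using g(2) z by blast
  qed
  moreover from this have "I <+>\<^bsub>R\<^esub> PIdl k \<in> F" using k(1) j(3) by (auto simp: F_def)
  ultimately have "I <+>\<^bsub>R\<^esub> PIdl k = M" using M(2) by blast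
  then have "k \<in> I <+>\<^bsub>R\<^esub> PIdl j" using self[OF k(1)] j(2) by simp
  then obtain i r where i: "i \<in> I" "r \<in> carrier R" "k = i \<oplus> r \<otimes> j" unfolding mem by blast
  have "(j \<ominus> z \<otimes> k) \<oplus> z \<otimes> i \<in> I" using k i z I.I_l_closed I.a_closed by blast
  moreover have "(j \<ominus> z \<otimes> k) \<oplus> z \<otimes> i = (\<one> \<ominus> z \<otimes> r) \<otimes> j"
    using i jc z I.Icarr by algebra
  ultimately have *: "(\<one> \<ominus> z \<otimes> r) \<otimes> j \<in> I" by simp
  have u: "\<one> \<ominus> z \<otimes> r \<in> Units R" using assms(2) i(2) by (intro one_minus_unit I_r_closed)
  then have "j \<in> I" using * jc I.mem_if_unit_mult_mem by blast
  then show "f \<in> I" using j(3) unfolding j(2) mem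
    using I.I_l_closed I.a_closed by blast
qed

end

section \<open>Two generators and Krull dimension two\<close>

locale two_generated_local_ring = noetherian_local_ring \<mm> R for \<mm> and R (structure) +
  fixes x y
  assumes x_closed [simp, intro]: "x \<in> carrier R"
    and y_closed [simp, intro]: "y \<in> carrier R"
    and max_eq: "\<mm> = {x \<otimes> a \<oplus> y \<otimes> b | a b. a \<in> carrier R \<and> b \<in> carrier R}"
begin

text \<open>The image of \<open>f\<close> in the quotient by \<open>x\<close> has order \<open>n\<close> with respect to
\<open>y\<close>. The name is that of the hypothesis in the Weierstrass preparation theorem, where \<open>n\<close>
becomes the degree of a polynomial in \<open>y\<close>.\<close>

definition regular_of_order :: "nat \<Rightarrow> 'a \<Rightarrow> bool" where
  "regular_of_order n f \<longleftrightarrow> (\<exists>u\<in>Units R. \<exists>c\<in>carrier R. f = u \<otimes> y [^] n \<oplus> x \<otimes> c)"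

lemma regular_of_orderE:
  assumes "regular_of_order n f"
  obtains u c where "u \<in> Units R" "u \<in> carrier R" "c \<in> carrier R" "f = u \<otimes> y [^] n \<oplus> x \<otimes> c"
  using assms unfolding regular_of_order_def by blast

lemma x_in_max: "x \<in> \<mm>"
proof -
  have "x = x \<otimes> \<one> \<oplus> y \<otimes> \<zero>" by simp
  then show ?thesis unfolding max_eq by blast
qed

lemma y_in_max: "y \<in> \<mm>"
proof -
  have "y = x \<otimes> \<zero> \<oplus> y \<otimes> \<one>" by simp
  then show ?thesis unfolding max_eq by blast
qed

lemma regular_of_order_closed: "regular_of_order n f \<Longrightarrow> f \<in> carrier R"
  by (auto elim: regular_of_orderE)

text \<open>Expansion of \<open>f\<close> modulo \<open>x\<close> in powers of \<open>y\<close>: a coefficient that is not a unit lies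
in \<open>(x, y)\<close> and can be pushed to the next power.\<close>

lemma regular_or_pow_multiple:
  assumes "f \<in> carrier R"
  shows "(\<exists>i<n. regular_of_order i f) \<or> (\<exists>h\<in>carrier R. \<exists>c\<in>carrier R. f = y [^] n \<otimes> h \<oplus> x \<otimes> c)"
proof (induction n)
  case 0
  have "f = y [^] (0::nat) \<otimes> f \<oplus> x \<otimes> \<zero>" using assms by simp
  then show ?case using assms by blast
next
  case (Suc n)
  show ?case
  proof (cases "\<exists>i<n. regular_of_order i f")
    case True
    then show ?thesis using less_SucI by blast
  next
    case False
    then obtain h c where h: "h \<in> carrier R" "c \<in> carrier R" "f = y [^] n \<otimes> h \<oplus> x \<otimes> c"
      using Suc by blast
    show ?thesis
    proof (cases "h \<in> \<mm>")
      case True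
      then obtain a b where ab: "a \<in> carrier R" "b \<in> carrier R" "h = x \<otimes> a \<oplus> y \<otimes> b"
        unfolding max_eq by blast
      have "f = y [^] Suc n \<otimes> b \<oplus> x \<otimes> (y [^] n \<otimes> a \<oplus> c)"
        unfolding h(3) ab(3) nat_pow_Suc using ab(1,2) h(1,2) x_closed y_closed nat_pow_closed[OF y_closed, of n] by algebra
      then show ?thesis using ab h by blast
    next
      case False
      then have "h \<in> Units R" using h(1) unit_if_notin_max by blast
      then have "regular_of_order n f"
        unfolding regular_of_order_def h(3) using h(1,2) m_comm by (metis nat_pow_closed y_closed)
      then show ?thesis by blast
    qed
  qed
qed

text \<open>Krull's principal ideal theorem, in the form that \<open>x\<close> cannot generate an \<open>\<mm>\<close>-primary ideal
modulo \<open>P0\<close>. Suppose it did. The ideals containing \<open>x\<close> and \<open>P0\<close> would then be the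
finitely many \<open>(x, y^i)\<close> with \<open>i \<le> n\<close> that contain \<open>P0\<close>. For \<open>a \<in> P1 - P0\<close> consider \<open>I k\<close>, the preimage in
\<open>R\<close> of the ideal generated by \<open>a^k\<close> in the localization of \<open>R / P0\<close> at \<open>P1\<close>.
These ideals decrease, so modulo \<open>x\<close> two consecutive ones coincide. Since \<open>x \<notin> P1\<close>, Nakayama's
lemma gives \<open>I k = I (k + 1)\<close>, and \<open>a^k \<in> I (k + 1)\<close> would make \<open>a\<close> a unit in that
localization.\<close>

lemma prime_chain_imp_pow_notin:
  assumes P0: "primeideal P0 R" and P1: "primeideal P1 R" and sub: "P0 \<subset> P1" "P1 \<subset> \<mm>"
  shows "\<not> (\<exists>p\<in>P0. \<exists>c\<in>carrier R. y [^] (n::nat) = x \<otimes> c \<oplus> p)"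
proof
  assume "\<exists>p\<in>P0. \<exists>c\<in>carrier R. y [^] n = x \<otimes> c \<oplus> p"
  then obtain p0 c0 where pc: "p0 \<in> P0" "c0 \<in> carrier R" "y [^] n = x \<otimes> c0 \<oplus> p0" by blast
  interpret P0: primeideal P0 R by fact
  interpret P1: primeideal P1 R by fact
  have x_notin: "x \<notin> P1"
  proof
    assume x: "x \<in> P1"
    then have "y [^] n \<in> P1"
      unfolding pc(3) using pc sub by (intro P1.a_closed P1.I_r_closed) auto
    then have "y \<in> P1" by (rule P1.mem_if_pow_mem) simp
    then have "\<mm> \<subseteq> P1" unfolding max_eq using x by (auto intro!: P1.a_closed P1.I_r_closed)
    then show False using sub by blast
  qed
  obtain a where a: "a \<in> P1" "a \<notin> P0" using sub by blast
  have ac [simp]: "a \<in> carrier R" using a P1.Icarr by blast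
  define I where "I k = {r \<in> carrier R. \<exists>s\<in>carrier R - P1. \<exists>t\<in>carrier R. s \<otimes> r \<ominus> t \<otimes> a [^] k \<in> P0}"
    for k :: nat
  have I_memI: "r \<in> I k"
    if "s \<otimes> r \<ominus> t \<otimes> a [^] k \<in> P0" "s \<notin> P1" "r \<in> carrier R" "s \<in> carrier R" "t \<in> carrier R"
    for r s t k
    using that by (auto simp: I_def)
  have one_P1: "\<one> \<notin> P1" using P1.one_imp_carrier P1.I_notcarr by auto
  have I_carr: "I k \<subseteq> carrier R" for k by (auto simp: I_def)
  have P0_I: "p \<in> I k" if "p \<in> P0" for p k
  proof -
    have "\<one> \<otimes> p \<ominus> \<zero> \<otimes> a [^] k \<in> P0" using that P0.Icarr by (simp add: minus_eq)
    then show ?thesis using that P0.Icarr one_P1 by (intro I_memI[of \<one> _ \<zero>]) auto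
  qed
  have add_I: "r1 \<oplus> r2 \<in> I k" if r: "r1 \<in> I k" "r2 \<in> I k" for r1 r2 k
  proof -
    obtain s1 t1 where 1: "s1 \<in> carrier R" "s1 \<notin> P1" "t1 \<in> carrier R" "s1 \<otimes> r1 \<ominus> t1 \<otimes> a [^] k \<in> P0"
      using r by (auto simp: I_def)
    obtain s2 t2 where 2: "s2 \<in> carrier R" "s2 \<notin> P1" "t2 \<in> carrier R" "s2 \<otimes> r2 \<ominus> t2 \<otimes> a [^] k \<in> P0"
      using r by (auto simp: I_def)
    have c: "r1 \<in> carrier R" "r2 \<in> carrier R" "a [^] k \<in> carrier R" using r I_carr by auto
    have "s1 \<otimes> s2 \<notin> P1" using 1 2 P1.I_prime by blast
    moreover have "s2 \<otimes> (s1 \<otimes> r1 \<ominus> t1 \<otimes> a [^] k) \<oplus> s1 \<otimes> (s2 \<otimes> r2 \<ominus> t2 \<otimes> a [^] k) \<in> P0"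
      using 1 2 by (intro P0.a_closed P0.I_l_closed)
    moreover have "s2 \<otimes> (s1 \<otimes> r1 \<ominus> t1 \<otimes> a [^] k) \<oplus> s1 \<otimes> (s2 \<otimes> r2 \<ominus> t2 \<otimes> a [^] k)
        = (s1 \<otimes> s2) \<otimes> (r1 \<oplus> r2) \<ominus> (s2 \<otimes> t1 \<oplus> s1 \<otimes> t2) \<otimes> a [^] k"
      using 1(1,3) 2(1,3) c by algebra
    ultimately show ?thesis using 1(1,3) 2(1,3) c
      by (intro I_memI[of "s1 \<otimes> s2" _ "s2 \<otimes> t1 \<oplus> s1 \<otimes> t2"]) auto
  qed
  have mult_I: "z \<otimes> r \<in> I k" if r: "r \<in> I k" "z \<in> carrier R" for r z k
  proof -
    obtain s t where 1: "s \<in> carrier R" "s \<notin> P1" "t \<in> carrier R" "s \<otimes> r \<ominus> t \<otimes> a [^] k \<in> P0"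
      using r by (auto simp: I_def)
    have c: "r \<in> carrier R" "a [^] k \<in> carrier R" using that I_carr by auto
    have "z \<otimes> (s \<otimes> r \<ominus> t \<otimes> a [^] k) \<in> P0" using 1 that by (intro P0.I_l_closed)
    moreover have "z \<otimes> (s \<otimes> r \<ominus> t \<otimes> a [^] k) = s \<otimes> (z \<otimes> r) \<ominus> (z \<otimes> t) \<otimes> a [^] k"
      using 1(1,3) c that(2) by algebra
    ultimately show ?thesis using 1(1,2,3) c that(2) by (intro I_memI[of s _ "z \<otimes> t"]) auto
  qed
  have ideal_I: "ideal (I k) R" for k
  proof (rule idealI)
    show "ring R" by (rule ring_axioms)
    show "subgroup (I k) (add_monoid R)"
    proof
      show "I k \<subseteq> carrier (add_monoid R)" using I_carr by simp
      show "\<one>\<^bsub>add_monoid R\<^esub> \<in> I k" using P0_I P0.zero_closed by simp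
      show "r1 \<otimes>\<^bsub>add_monoid R\<^esub> r2 \<in> I k" if "r1 \<in> I k" "r2 \<in> I k" for r1 r2
        using add_I[OF that] by simp
      show "inv\<^bsub>add_monoid R\<^esub> r \<in> I k" if "r \<in> I k" for r
      proof -
        have "(\<ominus> \<one>) \<otimes> r \<in> I k" using that by (intro mult_I) auto
        then show ?thesis using that I_carr[of k] by (auto simp: a_inv_def[symmetric] l_minus)
      qed
    qed
    show "z \<otimes> r \<in> I k" if "r \<in> I k" "z \<in> carrier R" for r z
      using mult_I[OF that] .
    show "r \<otimes> z \<in> I k" if "r \<in> I k" "z \<in> carrier R" for r z
      using mult_I[OF that] that I_carr[of k] by (simp add: m_comm subset_iff)
  qed
  have I_anti: "I (Suc k) \<subseteq> I k" for k
  proof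
    fix r assume "r \<in> I (Suc k)"
    then obtain s t where 1: "r \<in> carrier R" "s \<in> carrier R - P1" "t \<in> carrier R"
        "s \<otimes> r \<ominus> t \<otimes> a [^] Suc k \<in> P0"
      by (auto simp: I_def)
    moreover have "t \<otimes> a [^] Suc k = (t \<otimes> a) \<otimes> a [^] k"
      using 1(3) ac nat_pow_closed[OF ac, of k] unfolding nat_pow_Suc by algebra
    ultimately show "r \<in> I k" by (intro I_memI[of s _ "t \<otimes> a"]) auto
  qed
  define T where "T k i \<longleftrightarrow> (\<exists>j\<in>I k. \<exists>c\<in>carrier R. y [^] i = j \<oplus> x \<otimes> c)" for k i :: nat
  have T_n: "T k n" for k
    unfolding T_def using pc P0_I[OF pc(1)] P0.Icarr a_comm by (metis m_closed x_closed)
  have T_anti: "T (Suc k) i \<Longrightarrow> T k i" for k i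
    unfolding T_def using I_anti by blast
  \<comment> \<open>The ideal \<open>I k + (x)\<close> equals \<open>(x, y^(d k))\<close>, so it is determined by \<open>d k \<le> n\<close>.\<close>
  define d where "d k = (LEAST i. T k i)" for k
  have d_T: "T k (d k)" for k unfolding d_def using T_n by (rule LeastI)
  have d_le: "d k \<le> i" if "T k i" for k i unfolding d_def using that by (rule Least_le)
  have "\<exists>k. d (Suc k) = d k"
  proof (rule ccontr)
    assume "\<nexists>k. d (Suc k) = d k"
    then have "d k < d (Suc k)" for k using d_le[OF T_anti[OF d_T[of "Suc k"]]] by (metis le_neq_implies_less)
    then have "strict_mono d" by (simp add: strict_mono_Suc_iff)
    then have "Suc n \<le> d (Suc n)" by (rule strict_mono_imp_increasing)
    then show False using d_le[OF T_n[of "Suc n"]] by simp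
  qed
  then obtain k where k: "d (Suc k) = d k" by blast
  interpret Ik: ideal "I k" R by (rule ideal_I)
  interpret ISk: ideal "I (Suc k)" R by (rule ideal_I)
  have "I k \<subseteq> I (Suc k)"
  proof (rule principal_nakayama[OF ideal_I x_in_max I_carr])
    fix r assume r: "r \<in> I k"
    then have rc: "r \<in> carrier R" using I_carr by blast
    obtain i h c where i: "d k \<le> i" "h \<in> carrier R" "c \<in> carrier R" "r = h \<otimes> y [^] i \<oplus> x \<otimes> c"
      using regular_or_pow_multiple[OF rc, of n]
    proof (elim disjE exE conjE)
      fix i assume "regular_of_order i r"
      then obtain u c where u: "u \<in> Units R" "u \<in> carrier R" "c \<in> carrier R" "r = u \<otimes> y [^] i \<oplus> x \<otimes> c"
        by (rule regular_of_orderE)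
      have yi: "y [^] i \<in> carrier R" by simp
      have "y [^] i = inv u \<otimes> (u \<otimes> y [^] i \<oplus> x \<otimes> c) \<oplus> x \<otimes> (\<ominus> (inv u \<otimes> c))"
      proof -
        have "inv u \<otimes> (u \<otimes> y [^] i \<oplus> x \<otimes> c) \<oplus> x \<otimes> (\<ominus> (inv u \<otimes> c)) = (inv u \<otimes> u) \<otimes> y [^] i"
          using u(2,3) Units_inv_closed[OF u(1)] yi x_closed by algebra
        then show ?thesis using u(1) yi by simp
      qed
      moreover have "inv u \<otimes> (u \<otimes> y [^] i \<oplus> x \<otimes> c) \<in> I k" using mult_I[OF r] u by auto
      ultimately have "T k i" unfolding T_def using u by blast
      then show ?thesis using u that d_le by blast
    next
      assume "\<exists>h\<in>carrier R. \<exists>c\<in>carrier R. r = y [^] n \<otimes> h \<oplus> x \<otimes> c"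
      then show ?thesis using that[of n] d_le[OF T_n] m_comm by (metis nat_pow_closed y_closed)
    qed
    have "T (Suc k) (d k)" using d_T[of "Suc k"] k by simp
    then obtain j e where j: "j \<in> I (Suc k)" "e \<in> carrier R" "y [^] d k = j \<oplus> x \<otimes> e"
      unfolding T_def by blast
    have jc: "j \<in> carrier R" using j(1) I_carr by blast
    define w where "w = h \<otimes> y [^] (i - d k)"
    have w: "w \<in> carrier R" using i by (simp add: w_def)
    have "h \<otimes> y [^] i = w \<otimes> y [^] d k"
      unfolding w_def using i by (simp add: m_assoc nat_pow_mult)
    then have r_eq: "r = w \<otimes> (j \<oplus> x \<otimes> e) \<oplus> x \<otimes> c" using i(4) j(3) by simp
    define q where "q = w \<otimes> e \<oplus> c"
    have q: "q \<in> carrier R" using w j i by (simp add: q_def)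
    have rq: "r \<ominus> x \<otimes> q = w \<otimes> j" unfolding r_eq q_def using w jc j(2) i(3) x_closed by algebra
    have wj: "w \<otimes> j \<in> I (Suc k)" using mult_I j(1) w by blast
    have "x \<otimes> q = r \<ominus> w \<otimes> j"
      unfolding r_eq q_def using w jc j(2) i(3) x_closed by algebra
    moreover have "r \<ominus> w \<otimes> j \<in> I k"
      unfolding minus_eq using r wj I_anti by (intro Ik.a_closed Ik.a_inv_closed) auto
    ultimately have "x \<otimes> q \<in> I k" by simp
    then obtain s t where st: "s \<in> carrier R" "s \<notin> P1" "t \<in> carrier R" "s \<otimes> (x \<otimes> q) \<ominus> t \<otimes> a [^] k \<in> P0"
      unfolding I_def by blast
    \<comment> \<open>\<open>x\<close> is invertible in the localization at \<open>P1\<close>, so it can be cancelled.\<close>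
    have "s \<otimes> x \<notin> P1" using st x_notin P1.I_prime by blast
    moreover have "s \<otimes> x \<otimes> q \<ominus> t \<otimes> a [^] k \<in> P0" using st q by (simp add: m_assoc)
    ultimately have "q \<in> I k" using q st by (intro I_memI[of "s \<otimes> x" _ t]) auto
    moreover have "r \<ominus> x \<otimes> q \<in> I (Suc k)" unfolding rq by (rule wj)
    ultimately show "\<exists>q\<in>I k. r \<ominus> x \<otimes> q \<in> I (Suc k)" by blast
  qed
  moreover have "a [^] k \<in> I k"
  proof -
    have "\<one> \<otimes> a [^] k \<ominus> \<one> \<otimes> a [^] k \<in> P0" using P0.zero_closed by (simp add: r_neg minus_eq)
    then show ?thesis using one_P1 by (intro I_memI[of \<one> _ \<one>]) auto
  qed
  ultimately have "a [^] k \<in> I (Suc k)" by blast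
  then obtain s t where st: "s \<in> carrier R" "s \<notin> P1" "t \<in> carrier R" "s \<otimes> a [^] k \<ominus> t \<otimes> a [^] Suc k \<in> P0"
    unfolding I_def by blast
  have ak: "a [^] k \<in> carrier R" by simp
  have "s \<otimes> a [^] k \<ominus> t \<otimes> a [^] Suc k = a [^] k \<otimes> (s \<ominus> t \<otimes> a)"
    unfolding nat_pow_Suc using st(1,3) ac ak by algebra
  then have "a [^] k \<otimes> (s \<ominus> t \<otimes> a) \<in> P0" using st by simp
  moreover have "a [^] k \<notin> P0"
  proof (induction k)
    case 0
    show ?case using P0.one_imp_carrier P0.I_notcarr by auto
  next
    case (Suc k)
    then show ?case using P0.I_prime[of "a [^] k" a] a by auto
  qed
  ultimately have "s \<ominus> t \<otimes> a \<in> P1"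
    using P0.I_prime[OF ak, of "s \<ominus> t \<otimes> a"] st sub by auto
  then have "(s \<ominus> t \<otimes> a) \<oplus> t \<otimes> a \<in> P1" using a st by (intro P1.a_closed P1.I_l_closed)
  moreover have "(s \<ominus> t \<otimes> a) \<oplus> t \<otimes> a = s" using st(1,3) ac by algebra
  ultimately show False using st by simp
qed

lemma regular_of_order_imp_pow:
  assumes "ideal K R" "regular_of_order i f" "f \<in> K"
  shows "\<exists>p\<in>K. \<exists>c\<in>carrier R. y [^] i = x \<otimes> c \<oplus> p"
proof -
  interpret K: ideal K R by fact
  obtain u c where u: "u \<in> Units R" "u \<in> carrier R" "c \<in> carrier R" "f = u \<otimes> y [^] i \<oplus> x \<otimes> c"
    using assms(2) by (rule regular_of_orderE)
  have yi: "y [^] i \<in> carrier R" by simp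
  have "x \<otimes> (\<ominus> (inv u \<otimes> c)) \<oplus> inv u \<otimes> (u \<otimes> y [^] i \<oplus> x \<otimes> c) = (inv u \<otimes> u) \<otimes> y [^] i"
    using u(2,3) Units_inv_closed[OF u(1)] yi x_closed by algebra
  moreover have "(inv u \<otimes> u) \<otimes> y [^] i = y [^] i" using u(1) yi by simp
  ultimately have "y [^] i = x \<otimes> (\<ominus> (inv u \<otimes> c)) \<oplus> inv u \<otimes> f" unfolding u(4) by (simp only:)
  moreover have "inv u \<otimes> f \<in> K" using assms(3) u(1) by (intro K.I_l_closed) auto
  moreover have "\<ominus> (inv u \<otimes> c) \<in> carrier R" using u by auto
  ultimately show ?thesis by blast
qed

text \<open>Krull's intersection theorem modulo \<open>x\<close>. If \<open>f = y h\<close> modulo \<open>x\<close> has no finite order,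
neither has \<open>h\<close>, so the elements without finite order form a set \<open>J\<close> with
\<open>J \<subseteq> (x) + y J\<close>.\<close>

lemma x_dvd_if_not_regular:
  assumes "f \<in> carrier R" "\<And>n. \<not> regular_of_order n f"
  shows "x divides f"
proof -
  define J where "J = {f \<in> carrier R. \<forall>n. \<not> regular_of_order n f}"
  have "J \<subseteq> PIdl x"
  proof (rule principal_nakayama[OF cgenideal_ideal[OF x_closed] y_in_max])
    show "J \<subseteq> carrier R" by (auto simp: J_def)
    fix f assume f: "f \<in> J"
    then have "f \<in> carrier R" by (auto simp: J_def)
    then obtain h c where h: "h \<in> carrier R" "c \<in> carrier R" "f = y [^] (1::nat) \<otimes> h \<oplus> x \<otimes> c"
      using regular_or_pow_multiple[of f 1] f unfolding J_def by blast
    have f_eq: "f = y \<otimes> h \<oplus> x \<otimes> c" unfolding h(3) by simp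
    have "\<not> regular_of_order n h" for n
    proof
      assume "regular_of_order n h"
      then obtain u d where u: "u \<in> Units R" "u \<in> carrier R" "d \<in> carrier R" "h = u \<otimes> y [^] n \<oplus> x \<otimes> d"
        by (rule regular_of_orderE)
      have "f = u \<otimes> y [^] Suc n \<oplus> x \<otimes> (y \<otimes> d \<oplus> c)"
        unfolding f_eq u(4) nat_pow_Suc
        using u(2,3) h(2) x_closed y_closed nat_pow_closed[OF y_closed, of n] by algebra
      then have "regular_of_order (Suc n) f" unfolding regular_of_order_def using u h by blast
      then show False using f by (simp add: J_def)
    qed
    then have "h \<in> J" using h by (simp add: J_def)
    moreover have "f \<ominus> y \<otimes> h = c \<otimes> x"
      unfolding f_eq using h(1,2) x_closed y_closed by algebra
    then have "f \<ominus> y \<otimes> h \<in> PIdl x" using h by (auto simp: cgenideal_def)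
    ultimately show "\<exists>h\<in>J. f \<ominus> y \<otimes> h \<in> PIdl x" by blast
  qed
  moreover have "f \<in> J" using assms by (simp add: J_def)
  ultimately show ?thesis by (auto simp: cgenideal_def factor_def m_comm)
qed

text \<open>By the principal ideal theorem \<open>P0\<close> contains no regular element, so all its elements are multiples of
\<open>x\<close>. Moreover
\<open>x \<notin> P0\<close>: otherwise \<open>P1\<close>, being strictly larger than \<open>(x)\<close>, would contain a power
of \<open>y\<close> and hence \<open>\<mm>\<close>. So \<open>P0 = x P0\<close>, and \<open>P0\<close> vanishes by
Nakayama's lemma.\<close>

lemma domain_if_prime_chain:
  assumes P0: "primeideal P0 R" and P1: "primeideal P1 R" and sub: "P0 \<subset> P1" "P1 \<subset> \<mm>"
  shows "domain R" and "x \<noteq> \<zero>" and "\<not> x divides y [^] (n::nat)"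
proof -
  interpret P0: primeideal P0 R by fact
  interpret P1: primeideal P1 R by fact
  show nd: "\<not> x divides y [^] (n::nat)" for n
    using prime_chain_imp_pow_notin[OF assms, of n] P0.zero_closed
    unfolding factor_def by (metis m_closed r_zero x_closed)
  have x_dvd: "x divides f" if "f \<in> P0" for f
  proof (rule x_dvd_if_not_regular)
    show "f \<in> carrier R" using that P0.Icarr by blast
    show "\<not> regular_of_order n f" for n
      using regular_of_order_imp_pow[OF P0.is_ideal _ that] prime_chain_imp_pow_notin[OF assms] by blast
  qed
  have x_notin: "x \<notin> P0"
  proof
    assume x: "x \<in> P0"
    obtain a where a: "a \<in> P1" "a \<notin> P0" using sub by blast
    have "a \<in> carrier R" using a P1.Icarr by blast
    moreover have "\<not> x divides a"
      using a x P0.I_r_closed by (auto simp: factor_def)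
    ultimately obtain i where "regular_of_order i a"
      using x_dvd_if_not_regular by blast
    then obtain p c where p: "p \<in> P1" "c \<in> carrier R" "y [^] i = x \<otimes> c \<oplus> p"
      using regular_of_order_imp_pow[OF P1.is_ideal _ a(1)] by blast
    have xP1: "x \<in> P1" using x sub by blast
    have yi: "y [^] i \<in> P1" unfolding p(3) using p xP1 by (intro P1.a_closed P1.I_r_closed)
    then have "y \<in> P1" by (rule P1.mem_if_pow_mem) simp
    then have "\<mm> \<subseteq> P1" unfolding max_eq using xP1 by (auto intro!: P1.a_closed P1.I_r_closed)
    then show False using sub by blast
  qed
  have "P0 \<subseteq> {\<zero>}"
  proof (rule principal_nakayama[OF zeroideal x_in_max])
    show "P0 \<subseteq> carrier R" using P0.Icarr by blast
    fix f assume f: "f \<in> P0"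
    then obtain g where g: "g \<in> carrier R" "f = x \<otimes> g" using x_dvd by (auto simp: factor_def)
    then have "g \<in> P0" using f x_notin P0.I_prime[of x g] by auto
    then show "\<exists>g\<in>P0. f \<ominus> x \<otimes> g \<in> {\<zero>}" using g by (auto simp: minus_eq r_neg intro!: bexI[of _ g])
  qed
  then have "P0 = {\<zero>}" using P0.zero_closed by blast
  then show "x \<noteq> \<zero>" using x_notin by blast
  show "domain R" using P0 \<open>P0 = {\<zero>}\<close> zeroprimeideal_domainI by simp
qed

end

lemma (in regular_local_ring) two_generated_domain:
  assumes "krull_dim R = 2"
  shows "domain R"
    and "\<exists>x y. two_generated_local_ring \<mm> R x y"
    and "\<And>x y. two_generated_local_ring \<mm> R x y \<Longrightarrow> x \<noteq> \<zero>"
    and "\<And>x y n. two_generated_local_ring \<mm> R x y \<Longrightarrow> \<not> x divides y [^] (n::nat)"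
proof -
  obtain A where A: "A \<subseteq> carrier R" "finite A" "enat (card A) = krull_dim R" "\<mm> = Idl A"
    using regular by blast
  have "card A = 2" using A(3) assms by (simp add: numeral_eq_enat)
  then obtain x y where xy: "A = {x, y}" by (auto simp: card_2_iff)
  have xy_closed: "x \<in> carrier R" "y \<in> carrier R" using A(1) xy by auto
  define K where "K = PIdl x <+>\<^bsub>R\<^esub> PIdl y"
  have mem_K: "f \<in> K \<longleftrightarrow> (\<exists>a\<in>carrier R. \<exists>b\<in>carrier R. f = x \<otimes> a \<oplus> y \<otimes> b)" for f
    unfolding K_def using xy_closed by (fastforce simp: set_add_def' cgenideal_def m_comm)
  have "\<mm> = {x \<otimes> a \<oplus> y \<otimes> b | a b. a \<in> carrier R \<and> b \<in> carrier R}"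
  proof
    have "\<mm> \<subseteq> K"
      unfolding A(4)
    proof (rule genideal_minimal)
      show "ideal K R" unfolding K_def using xy_closed by (intro add_ideals cgenideal_ideal)
      have "x = x \<otimes> \<one> \<oplus> y \<otimes> \<zero>" "y = x \<otimes> \<zero> \<oplus> y \<otimes> \<one>" using xy_closed by auto
      then show "A \<subseteq> K" unfolding xy using mem_K by blast
    qed
    then show "\<mm> \<subseteq> {x \<otimes> a \<oplus> y \<otimes> b | a b. a \<in> carrier R \<and> b \<in> carrier R}"
      using mem_K by blast
    have "x \<in> \<mm>" "y \<in> \<mm>" using genideal_self[OF A(1)] A(4) xy by auto
    then show "{x \<otimes> a \<oplus> y \<otimes> b | a b. a \<in> carrier R \<and> b \<in> carrier R} \<subseteq> \<mm>"
      by (auto intro!: a_closed I_r_closed)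
  qed
  then have two: "two_generated_local_ring \<mm> R x y"
    using xy_closed by unfold_locales
  then show "\<exists>x y. two_generated_local_ring \<mm> R x y" by blast
  have "\<exists>n P. 2 \<le> n \<and> (\<forall>i\<le>n. primeideal (P i) R) \<and> (\<forall>i<n. P i \<subset> P (Suc i))"
  proof (rule ccontr)
    assume no: "\<not> ?thesis"
    have "krull_dim R \<le> enat 1"
      unfolding krull_dim_def
    proof (rule Sup_least)
      fix v assume "v \<in> {enat n |n. \<exists>P. (\<forall>i\<le>n. primeideal (P i) R) \<and> (\<forall>i<n. P i \<subset> P (Suc i))}"
      then obtain n where n: "v = enat n"
        "\<exists>P. (\<forall>i\<le>n. primeideal (P i) R) \<and> (\<forall>i<n. P i \<subset> P (Suc i))" by blast
      then have "\<not> 2 \<le> n" using no by blast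
      then show "v \<le> enat 1" using n by simp
    qed
    then show False using assms by (simp add: numeral_eq_enat)
  qed
  then obtain n P where P: "(2::nat) \<le> n" "\<And>i. i \<le> n \<Longrightarrow> primeideal (P i) R"
    "\<And>i. i < n \<Longrightarrow> P i \<subset> P (Suc i)" by blast
  have prime: "primeideal (P 0) R" "primeideal (P 1) R" "primeideal (P 2) R" using P by auto
  have sub: "P 0 \<subset> P 1" "P 1 \<subset> P 2" using P(3)[of 0] P(3)[of 1] P(1) by (auto simp: numeral_2_eq_2)
  interpret P2: primeideal "P 2" R by (rule prime)
  have "P 2 \<subseteq> \<mm>"
    using P2.is_ideal P2.one_imp_carrier P2.I_notcarr by (intro proper_ideal_subset_max) auto
  with sub have "P 1 \<subset> \<mm>" by blast
  then show "\<not> x divides y [^] (n::nat)" if "two_generated_local_ring \<mm> R x y" for x y n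
    using two_generated_local_ring.domain_if_prime_chain(3)[OF that] prime sub by blast
  from sub \<open>P 1 \<subset> \<mm>\<close> show "x \<noteq> \<zero>" if "two_generated_local_ring \<mm> R x y" for x y
    using two_generated_local_ring.domain_if_prime_chain(2)[OF that] prime by blast
  show "domain R"
    by (rule two_generated_local_ring.domain_if_prime_chain(1)[OF two prime(1,2) sub(1)]) fact
qed

section \<open>Powers of the maximal ideal\<close>

text \<open>The consequences of dimension two on which everything below relies: \<open>x, y\<close> is a regular
sequence generating \<open>\<mm>\<close>, and the quotient by \<open>x\<close> is a discrete valuation ring.\<close>

locale regular_parameters = two_generated_local_ring \<mm> R x y + domain R
  for \<mm> and R (structure) and x y +
  assumes x_nonzero: "x \<noteq> \<zero>"
    and not_x_dvd_pow_y: "\<not> x divides y [^] (n::nat)"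
begin

lemma regular_imp_not_x_dvd:
  assumes "regular_of_order n f"
  shows "\<not> x divides f"
proof
  assume "x divides f"
  then have "f \<in> PIdl x" by (auto simp: factor_def cgenideal_def m_comm)
  then obtain p c where p: "p \<in> PIdl x" "c \<in> carrier R" "y [^] n = x \<otimes> c \<oplus> p"
    using regular_of_order_imp_pow[OF cgenideal_ideal[OF x_closed] assms] by blast
  then obtain d where d: "d \<in> carrier R" "p = d \<otimes> x" by (auto simp: cgenideal_def)
  have "x \<otimes> c \<oplus> d \<otimes> x = x \<otimes> (c \<oplus> d)" using p(2) d(1) x_closed by algebra
  then have "y [^] n = x \<otimes> (c \<oplus> d)" using p(3) d(2) by simp
  then have "x divides y [^] n" unfolding factor_def using p d by blast
  then show False using not_x_dvd_pow_y by blast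
qed

lemma x_dvd_or_regular:
  assumes "f \<in> carrier R"
  shows "x divides f \<or> (\<exists>n. regular_of_order n f)"
  using x_dvd_if_not_regular[OF assms] by blast

lemma regular_of_order_mult:
  assumes "regular_of_order i f" "regular_of_order j g"
  shows "regular_of_order (i + j) (f \<otimes> g)"
proof -
  obtain u c where f: "u \<in> Units R" "u \<in> carrier R" "c \<in> carrier R" "f = u \<otimes> y [^] i \<oplus> x \<otimes> c"
    using assms(1) by (rule regular_of_orderE)
  obtain v d where g: "v \<in> Units R" "v \<in> carrier R" "d \<in> carrier R" "g = v \<otimes> y [^] j \<oplus> x \<otimes> d"
    using assms(2) by (rule regular_of_orderE)
  define e where "e = c \<otimes> (v \<otimes> y [^] j) \<oplus> (u \<otimes> y [^] i \<oplus> x \<otimes> c) \<otimes> d"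
  have e: "e \<in> carrier R" unfolding e_def using f g by auto
  have "f \<otimes> g = (u \<otimes> v) \<otimes> (y [^] i \<otimes> y [^] j) \<oplus> x \<otimes> e"
    unfolding f(4) g(4) e_def
    using f(2,3) g(2,3) x_closed nat_pow_closed[OF y_closed, of i] nat_pow_closed[OF y_closed, of j]
    by algebra
  then have "f \<otimes> g = (u \<otimes> v) \<otimes> y [^] (i + j) \<oplus> x \<otimes> e" by (simp add: nat_pow_mult)
  then show ?thesis unfolding regular_of_order_def using f(1) g(1) e by blast
qed

lemma x_dvd_cancel_pow_y:
  assumes "h \<in> carrier R" "x divides y [^] (n::nat) \<otimes> h"
  shows "x divides h"
proof (rule ccontr)
  assume "\<not> x divides h"
  then obtain i where "regular_of_order i h" using x_dvd_or_regular[OF assms(1)] by blast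
  moreover have "y [^] n = \<one> \<otimes> y [^] n \<oplus> x \<otimes> \<zero>" by simp
  then have "regular_of_order n (y [^] n)" unfolding regular_of_order_def by blast
  ultimately show False using regular_of_order_mult regular_imp_not_x_dvd assms(2) by blast
qed

text \<open>The power \<open>\<mm>^n\<close>, in a form suited to division by \<open>x\<close>: a form of degree \<open>n + 1\<close> in
\<open>x, y\<close> is \<open>x\<close> times a form of degree \<open>n\<close> plus a multiple of the pure power of
\<open>y\<close>.\<close>

primrec max_power :: "nat \<Rightarrow> 'a set" where
  "max_power 0 = carrier R"
| "max_power (Suc n) = {x \<otimes> g \<oplus> y [^] Suc n \<otimes> h | g h. g \<in> max_power n \<and> h \<in> carrier R}"

lemma max_power_SucE:
  assumes "f \<in> max_power (Suc n)"
  obtains g h where "g \<in> max_power n" "h \<in> carrier R" "f = x \<otimes> g \<oplus> y [^] Suc n \<otimes> h"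
  using assms by auto

lemma max_power_SucI:
  "g \<in> max_power n \<Longrightarrow> h \<in> carrier R \<Longrightarrow> x \<otimes> g \<oplus> y [^] Suc n \<otimes> h \<in> max_power (Suc n)"
  by auto

declare max_power.simps(2) [simp del]

lemma max_power_closed: "f \<in> max_power n \<Longrightarrow> f \<in> carrier R"
  by (induction n arbitrary: f) (auto elim!: max_power_SucE)

lemma max_power_add: "f \<in> max_power n \<Longrightarrow> g \<in> max_power n \<Longrightarrow> f \<oplus> g \<in> max_power n"
proof (induction n arbitrary: f g)
  case (Suc n)
  obtain f1 f2 where f: "f1 \<in> max_power n" "f2 \<in> carrier R" "f = x \<otimes> f1 \<oplus> y [^] Suc n \<otimes> f2"
    using Suc.prems(1) by (rule max_power_SucE)
  obtain g1 g2 where g: "g1 \<in> max_power n" "g2 \<in> carrier R" "g = x \<otimes> g1 \<oplus> y [^] Suc n \<otimes> g2"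
    using Suc.prems(2) by (rule max_power_SucE)
  have "f \<oplus> g = x \<otimes> (f1 \<oplus> g1) \<oplus> y [^] Suc n \<otimes> (f2 \<oplus> g2)"
    unfolding f(3) g(3)
    using f(2) g(2) max_power_closed[OF f(1)] max_power_closed[OF g(1)] x_closed
      nat_pow_closed[OF y_closed, of "Suc n"] by algebra
  then show ?case using f g Suc.IH max_power_SucI by auto
qed simp

lemma max_power_mult_left: "r \<in> carrier R \<Longrightarrow> f \<in> max_power n \<Longrightarrow> r \<otimes> f \<in> max_power n"
proof (induction n arbitrary: f)
  case (Suc n)
  obtain f1 f2 where f: "f1 \<in> max_power n" "f2 \<in> carrier R" "f = x \<otimes> f1 \<oplus> y [^] Suc n \<otimes> f2"
    using Suc.prems(2) by (rule max_power_SucE)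
  have "r \<otimes> f = x \<otimes> (r \<otimes> f1) \<oplus> y [^] Suc n \<otimes> (r \<otimes> f2)"
    unfolding f(3)
    using f(2) Suc.prems(1) max_power_closed[OF f(1)] x_closed
      nat_pow_closed[OF y_closed, of "Suc n"] by algebra
  then show ?case using f Suc max_power_SucI by auto
qed simp

lemma max_power_minus: "f \<in> max_power n \<Longrightarrow> g \<in> max_power n \<Longrightarrow> f \<ominus> g \<in> max_power n"
  using max_power_add[of f n "\<ominus> \<one> \<otimes> g"] max_power_mult_left[of "\<ominus> \<one>" g n] max_power_closed[of g n]
  by (simp add: minus_eq l_minus)

lemma zero_in_max_power: "\<zero> \<in> max_power n"
proof (induction n)
  case (Suc n)
  then show ?case using max_power_SucI[of \<zero> n \<zero>] by simp
qed simp

lemma x_mult_max_power: "g \<in> max_power n \<Longrightarrow> x \<otimes> g \<in> max_power (Suc n)"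
  using max_power_SucI[of g n \<zero>] max_power_closed[of g n] by simp

lemma y_mult_max_power: "g \<in> max_power n \<Longrightarrow> y \<otimes> g \<in> max_power (Suc n)"
proof (induction n arbitrary: g)
  case 0
  then show ?case using max_power_SucI[of \<zero> 0 g] by simp
next
  case (Suc n)
  obtain g1 g2 where g: "g1 \<in> max_power n" "g2 \<in> carrier R" "g = x \<otimes> g1 \<oplus> y [^] Suc n \<otimes> g2"
    using Suc.prems by (rule max_power_SucE)
  have "y \<otimes> g = x \<otimes> (y \<otimes> g1) \<oplus> (y [^] Suc n \<otimes> y) \<otimes> g2"
    unfolding g(3) using g(2) max_power_closed[OF g(1)] x_closed y_closed
      nat_pow_closed[OF y_closed, of "Suc n"] by algebra
  then show ?case using max_power_SucI[OF Suc.IH[OF g(1)] g(2)] by simp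
qed

lemma max_power_Suc_subset: "f \<in> max_power (Suc n) \<Longrightarrow> f \<in> max_power n"
proof (induction n arbitrary: f)
  case 0
  then show ?case using max_power_closed by simp
next
  case (Suc n)
  obtain g h where g: "g \<in> max_power (Suc n)" "h \<in> carrier R" "f = x \<otimes> g \<oplus> y [^] Suc (Suc n) \<otimes> h"
    using Suc.prems by (rule max_power_SucE)
  have "f = x \<otimes> g \<oplus> y [^] Suc n \<otimes> (y \<otimes> h)"
    unfolding g(3) using g(2) by (simp add: m_assoc)
  then show ?case using max_power_SucI[OF Suc.IH[OF g(1)], of "y \<otimes> h"] g(2) by simp
qed

lemma max_power_antimono: "m \<le> n \<Longrightarrow> f \<in> max_power n \<Longrightarrow> f \<in> max_power m"
  by (induction rule: dec_induct) (auto dest: max_power_Suc_subset)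

lemma pow_y_mult_max_power: "g \<in> max_power n \<Longrightarrow> y [^] (k::nat) \<otimes> g \<in> max_power (k + n)"
proof (induction k)
  case 0
  then show ?case using max_power_closed by simp
next
  case (Suc k)
  have "y [^] Suc k \<otimes> g = y \<otimes> (y [^] k \<otimes> g)"
    using max_power_closed[OF Suc.prems] by (simp add: m_ac)
  then show ?case using y_mult_max_power[OF Suc.IH[OF Suc.prems]] by simp
qed

lemma pow_x_mult_max_power: "g \<in> max_power n \<Longrightarrow> x [^] (k::nat) \<otimes> g \<in> max_power (k + n)"
proof (induction k)
  case 0
  then show ?case using max_power_closed by simp
next
  case (Suc k)
  have "x [^] Suc k \<otimes> g = x \<otimes> (x [^] k \<otimes> g)"
    using max_power_closed[OF Suc.prems] by (simp add: m_ac)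
  then show ?case using x_mult_max_power[OF Suc.IH[OF Suc.prems]] by simp
qed

lemma max_power_mult:
  "f \<in> max_power a \<Longrightarrow> g \<in> max_power b \<Longrightarrow> f \<otimes> g \<in> max_power (a + b)"
proof (induction a arbitrary: f)
  case 0
  then show ?case using max_power_mult_left by simp
next
  case (Suc a)
  obtain f1 f2 where f: "f1 \<in> max_power a" "f2 \<in> carrier R" "f = x \<otimes> f1 \<oplus> y [^] Suc a \<otimes> f2"
    using Suc.prems(1) by (rule max_power_SucE)
  have "f \<otimes> g = x \<otimes> (f1 \<otimes> g) \<oplus> y [^] Suc a \<otimes> (f2 \<otimes> g)"
    unfolding f(3) using f(2) max_power_closed[OF f(1)] max_power_closed[OF Suc.prems(2)] x_closed
      nat_pow_closed[OF y_closed, of "Suc a"] by algebra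
  moreover have "x \<otimes> (f1 \<otimes> g) \<in> max_power (Suc a + b)"
    using x_mult_max_power[OF Suc.IH[OF f(1) Suc.prems(2)]] by simp
  moreover have "y [^] Suc a \<otimes> (f2 \<otimes> g) \<in> max_power (Suc a + b)"
    using Suc.prems(2) f(2) by (intro pow_y_mult_max_power max_power_mult_left)
  ultimately show ?case using max_power_add by simp
qed

lemma max_power_1: "max_power (Suc 0) = \<mm>"
  unfolding max_eq by (auto simp: max_power.simps(2))

text \<open>Injectivity of multiplication by \<open>x\<close> on the associated graded ring: the pure power of \<open>y\<close> in
an expansion of \<open>x g\<close> must have a coefficient divisible by \<open>x\<close>.\<close>

lemma x_cancel_max_power:
  assumes "x \<otimes> g \<in> max_power (Suc n)" "g \<in> carrier R"
  shows "g \<in> max_power n"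
proof -
  obtain g1 h where g: "g1 \<in> max_power n" "h \<in> carrier R" "x \<otimes> g = x \<otimes> g1 \<oplus> y [^] Suc n \<otimes> h"
    using assms(1) by (rule max_power_SucE)
  have g1: "g1 \<in> carrier R" using g(1) by (rule max_power_closed)
  have yn: "y [^] Suc n \<in> carrier R" by (rule nat_pow_closed) simp
  have "y [^] Suc n \<otimes> h = (x \<otimes> g1 \<oplus> y [^] Suc n \<otimes> h) \<ominus> x \<otimes> g1"
    using g(2) g1 yn x_closed by algebra
  also have "\<dots> = x \<otimes> (g \<ominus> g1)" unfolding g(3)[symmetric] using assms(2) g1 x_closed by algebra
  finally have *: "y [^] Suc n \<otimes> h = x \<otimes> (g \<ominus> g1)" .
  then have "x divides y [^] Suc n \<otimes> h" unfolding factor_def using assms(2) g1 by blast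
  then have "x divides h" using x_dvd_cancel_pow_y g(2) by blast
  then obtain k where k: "k \<in> carrier R" "h = x \<otimes> k" by (auto simp: factor_def)
  have "x \<otimes> g = x \<otimes> (g1 \<oplus> y [^] Suc n \<otimes> k)"
    unfolding g(3) k(2) using k(1) g1 yn x_closed by algebra
  then have "g = g1 \<oplus> y [^] Suc n \<otimes> k" using assms(2) g1 k(1) yn x_nonzero by (simp add: m_lcancel)
  moreover have "y [^] Suc n \<otimes> k \<in> max_power n"
    using pow_y_mult_max_power[of k 0 "Suc n"] k(1) max_power_Suc_subset by simp
  ultimately show ?thesis using max_power_add g(1) by simp
qed

lemma pow_x_cancel_max_power:
  "x [^] (i::nat) \<otimes> g \<in> max_power (i + n) \<Longrightarrow> g \<in> carrier R \<Longrightarrow> g \<in> max_power n"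
proof (induction i)
  case (Suc i)
  have "x [^] Suc i \<otimes> g = x \<otimes> (x [^] i \<otimes> g)" using Suc.prems(2) by (simp add: m_ac)
  then show ?case using Suc x_cancel_max_power[of "x [^] i \<otimes> g" "i + n"] by simp
qed simp

lemma regular_notin_max_power:
  assumes "regular_of_order k f"
  shows "f \<notin> max_power (Suc k)"
proof
  assume "f \<in> max_power (Suc k)"
  then obtain g h where g: "g \<in> max_power k" "h \<in> carrier R" "f = x \<otimes> g \<oplus> y [^] Suc k \<otimes> h"
    by (rule max_power_SucE)
  obtain u c where u: "u \<in> Units R" "u \<in> carrier R" "c \<in> carrier R" "f = u \<otimes> y [^] k \<oplus> x \<otimes> c"
    using assms by (rule regular_of_orderE)
  have gc: "g \<in> carrier R" using g(1) by (rule max_power_closed)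
  have yk: "y [^] k \<in> carrier R" by simp
  have "y [^] k \<otimes> (u \<ominus> y \<otimes> h) = (u \<otimes> y [^] k \<oplus> x \<otimes> c) \<ominus> y [^] Suc k \<otimes> h \<ominus> x \<otimes> c"
    unfolding nat_pow_Suc using gc yk u(2,3) g(2) x_closed y_closed by algebra
  also have "\<dots> = (x \<otimes> g \<oplus> y [^] Suc k \<otimes> h) \<ominus> y [^] Suc k \<otimes> h \<ominus> x \<otimes> c"
    using u(4) g(3) by simp
  also have "\<dots> = x \<otimes> (g \<ominus> c)"
    using gc nat_pow_closed[OF y_closed, of "Suc k"] u(3) g(2) x_closed y_closed by algebra
  finally have "x divides y [^] k \<otimes> (u \<ominus> y \<otimes> h)" unfolding factor_def using gc u by blast
  then have "x divides (u \<ominus> y \<otimes> h)" using x_dvd_cancel_pow_y u g by auto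
  then obtain d where d: "d \<in> carrier R" "u \<ominus> y \<otimes> h = x \<otimes> d" by (auto simp: factor_def)
  have "u = (u \<ominus> y \<otimes> h) \<oplus> y \<otimes> h" using u(2) g(2) y_closed by algebra
  then have "u = x \<otimes> d \<oplus> y \<otimes> h" using d(2) by simp
  then have "u \<in> \<mm>" unfolding max_eq using d(1) g(2) by blast
  then show False using unit_notin_max u(1) by blast
qed

text \<open>Divide the leading form of \<open>f\<close> by the highest power of \<open>x\<close> it contains. The quotient still
contains a pure power of \<open>y\<close> and is therefore represented by an element \<open>g\<close> that is regular
of order equal to its degree.\<close>

lemma leading_form:
  assumes "f \<in> max_power a" "f \<notin> max_power (Suc a)"
  shows "\<exists>i j g. a = i + j \<and> regular_of_order j g \<and> g \<in> max_power j \<and> f \<ominus> x [^] i \<otimes> g \<in> max_power (Suc a)"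
  using assms
proof (induction a arbitrary: f)
  case 0
  then have "f \<in> Units R" using max_power_1 unit_if_notin_max by simp
  then have "regular_of_order 0 f"
    unfolding regular_of_order_def by (intro bexI[of _ f] bexI[of _ \<zero>]) auto
  moreover have "f \<ominus> x [^] (0::nat) \<otimes> f = \<zero>" using 0 by (simp add: minus_eq r_neg)
  then have "f \<ominus> x [^] (0::nat) \<otimes> f \<in> max_power (Suc 0)" by (simp only: zero_in_max_power)
  ultimately show ?case using 0(1) by (metis add_0)
next
  case (Suc a)
  obtain g h where g: "g \<in> max_power a" "h \<in> carrier R" "f = x \<otimes> g \<oplus> y [^] Suc a \<otimes> h"
    using Suc.prems(1) by (rule max_power_SucE)
  have gc: "g \<in> carrier R" using g(1) by (rule max_power_closed)
  have fc: "f \<in> carrier R" using Suc.prems(1) by (rule max_power_closed)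
  have yk: "y [^] Suc a \<in> carrier R" by (rule nat_pow_closed) simp
  show ?case
  proof (cases "h \<in> \<mm>")
    case False
    then have "h \<in> Units R" using unit_if_notin_max g(2) by blast
    moreover have "f = h \<otimes> y [^] Suc a \<oplus> x \<otimes> g"
      unfolding g(3) using g(2) gc yk x_closed by algebra
    ultimately have "regular_of_order (Suc a) f" unfolding regular_of_order_def using gc by blast
    moreover have "f \<ominus> x [^] (0::nat) \<otimes> f = \<zero>" using fc by (simp add: minus_eq r_neg)
    then have "f \<ominus> x [^] (0::nat) \<otimes> f \<in> max_power (Suc (Suc a))" by (simp only: zero_in_max_power)
    ultimately show ?thesis using Suc.prems(1) by (metis add_0)
  next
    case True
    then have "h \<in> max_power (Suc 0)" by (simp add: max_power_1)
    then have yh: "y [^] Suc a \<otimes> h \<in> max_power (Suc (Suc a))"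
      using pow_y_mult_max_power[of h "Suc 0" "Suc a"] by simp
    have "g \<notin> max_power (Suc a)"
      using Suc.prems(2) yh x_mult_max_power max_power_add unfolding g(3) by blast
    then obtain i j k where k: "a = i + j" "regular_of_order j k" "k \<in> max_power j"
      "g \<ominus> x [^] i \<otimes> k \<in> max_power (Suc a)" using Suc.IH g(1) by blast
    have kc: "k \<in> carrier R" using k(3) by (rule max_power_closed)
    have "f \<ominus> x [^] Suc i \<otimes> k = x \<otimes> (g \<ominus> x [^] i \<otimes> k) \<oplus> y [^] Suc a \<otimes> h"
      unfolding g(3) nat_pow_Suc[of x]
      using g(2) gc yk kc x_closed nat_pow_closed[OF x_closed, of i] by algebra
    then have "f \<ominus> x [^] Suc i \<otimes> k \<in> max_power (Suc (Suc a))"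
      using max_power_add[OF x_mult_max_power[OF k(4)] yh] by simp
    then show ?thesis using k by (intro exI[of _ "Suc i"] exI[of _ j] exI[of _ k]) simp
  qed
qed

text \<open>The associated graded ring is a domain: after cancelling the powers of \<open>x\<close> from the leading
forms, the product of two regular elements is again regular, and its order is the sum of the
degrees.\<close>

lemma max_power_mult_sharp:
  assumes f: "f \<in> max_power a" "f \<notin> max_power (Suc a)" and g: "g \<in> max_power b" "g \<notin> max_power (Suc b)"
  shows "f \<otimes> g \<notin> max_power (Suc (a + b))"
proof
  assume fg: "f \<otimes> g \<in> max_power (Suc (a + b))"
  obtain i j f' where f': "a = i + j" "regular_of_order j f'" "f' \<in> max_power j"
    "f \<ominus> x [^] i \<otimes> f' \<in> max_power (Suc a)" using leading_form[OF f] by blast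
  obtain k l g' where g': "b = k + l" "regular_of_order l g'" "g' \<in> max_power l"
    "g \<ominus> x [^] k \<otimes> g' \<in> max_power (Suc b)" using leading_form[OF g] by blast
  have c: "f \<in> carrier R" "g \<in> carrier R" "f' \<in> carrier R" "g' \<in> carrier R"
    "x [^] i \<in> carrier R" "x [^] k \<in> carrier R"
    using f g f' g' max_power_closed by auto
  have "(x [^] i \<otimes> x [^] k) \<otimes> (f' \<otimes> g')
      = f \<otimes> g \<ominus> (f \<ominus> x [^] i \<otimes> f') \<otimes> g \<ominus> (x [^] i \<otimes> f') \<otimes> (g \<ominus> x [^] k \<otimes> g')"
    using c by algebra
  also have "\<dots> \<in> max_power (Suc (a + b))"
  proof (intro max_power_minus fg)
    show "(f \<ominus> x [^] i \<otimes> f') \<otimes> g \<in> max_power (Suc (a + b))"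
      using max_power_mult[OF f'(4) g(1)] by simp
    show "(x [^] i \<otimes> f') \<otimes> (g \<ominus> x [^] k \<otimes> g') \<in> max_power (Suc (a + b))"
      using max_power_mult[OF pow_x_mult_max_power[OF f'(3), of i] g'(4)] f'(1) by simp
  qed
  finally have "x [^] (i + k) \<otimes> (f' \<otimes> g') \<in> max_power ((i + k) + Suc (j + l))"
    using f'(1) g'(1) by (simp add: nat_pow_mult ac_simps)
  then have "f' \<otimes> g' \<in> max_power (Suc (j + l))" by (rule pow_x_cancel_max_power) (use c in simp)
  then show False using regular_notin_max_power regular_of_order_mult f'(2) g'(2) by blast
qed

end

section \<open>The order of vanishing as a valuation\<close>

context regular_parameters
begin

definition max_order :: "'a \<Rightarrow> ereal" where
  "max_order f = (if f \<in> carrier R then SUP n\<in>{n. f \<in> max_power n}. ereal (real n) else undefined)"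

lemma max_order_le_if_notin:
  assumes "f \<in> carrier R" "f \<notin> max_power (Suc n)"
  shows "max_order f \<le> ereal (real n)"
  unfolding max_order_def
proof (simp add: assms(1), rule SUP_least, clarify)
  fix k assume "f \<in> max_power k"
  then have "\<not> Suc n \<le> k" using max_power_antimono assms(2) by blast
  then show "ereal (real k) \<le> ereal (real n)" by simp
qed

lemma le_max_order_iff:
  assumes "f \<in> carrier R"
  shows "ereal (real n) \<le> max_order f \<longleftrightarrow> f \<in> max_power n"
proof
  assume le: "ereal (real n) \<le> max_order f"
  show "f \<in> max_power n"
  proof (rule ccontr)
    assume notin: "f \<notin> max_power n"
    then obtain m where m: "n = Suc m" using assms by (cases n) auto
    have "ereal (real n) \<le> ereal (real m)"
      using le max_order_le_if_notin[OF assms notin[unfolded m]] by (rule order_trans)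
    then show False using m by simp
  qed
next
  assume "f \<in> max_power n"
  then show "ereal (real n) \<le> max_order f"
    unfolding max_order_def using assms by (auto intro: SUP_upper)
qed

lemma max_order_eqI:
  assumes "f \<in> max_power n" "f \<notin> max_power (Suc n)"
  shows "max_order f = ereal (real n)"
  using max_order_le_if_notin le_max_order_iff max_power_closed assms by (blast intro: antisym)

lemma max_order_infinite:
  assumes "f \<in> carrier R" "\<And>n. f \<in> max_power n"
  shows "max_order f = \<infinity>"
proof (rule ereal_top)
  fix B :: real
  obtain n :: nat where "B \<le> real n" using real_arch_simple by blast
  then show "ereal B \<le> max_order f"
    using le_max_order_iff[OF assms(1), of n] assms(2) order_trans[of "ereal B" "ereal (real n)"] by simp
qed

lemma max_order_cases:
  assumes "f \<in> carrier R"
  obtains (finite) n where "f \<in> max_power n" "f \<notin> max_power (Suc n)" "max_order f = ereal (real n)"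
  | (infinite) "\<And>n. f \<in> max_power n" "max_order f = \<infinity>"
proof (cases "\<forall>n. f \<in> max_power n")
  case True
  then show thesis using infinite max_order_infinite[OF assms] by blast
next
  case False
  define k where "k = (LEAST k. f \<notin> max_power k)"
  have k: "f \<notin> max_power k" unfolding k_def using False by (metis LeastI)
  then obtain n where n: "k = Suc n" using assms by (cases k) auto
  have "f \<in> max_power n" using n not_less_Least[of n "\<lambda>k. f \<notin> max_power k"] unfolding k_def by auto
  then show thesis using finite max_order_eqI k n by blast
qed

lemma max_order_mult:
  assumes f: "f \<in> carrier R" and g: "g \<in> carrier R"
  shows "max_order (f \<otimes> g) = max_order f + max_order g"
  using f
proof (cases rule: max_order_cases)
  case f: (finite a)
  show ?thesis
    using g
  proof (cases rule: max_order_cases)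
    case g: (finite b)
    then have "max_order (f \<otimes> g) = ereal (real (a + b))"
      using f max_power_mult max_power_mult_sharp by (intro max_order_eqI) auto
    then show ?thesis using f g by simp
  next
    case g: infinite
    have "f \<otimes> g \<in> max_power n" for n using g(1) max_power_mult_left assms by blast
    then have "max_order (f \<otimes> g) = \<infinity>" using assms by (intro max_order_infinite) auto
    then show ?thesis using f g by simp
  qed
next
  case f: infinite
  have "g \<otimes> f \<in> max_power n" for n using f(1) max_power_mult_left assms by blast
  then have "max_order (f \<otimes> g) = \<infinity>" using assms by (intro max_order_infinite) (auto simp: m_comm)
  moreover have "0 \<le> max_order g" using le_max_order_iff[OF g, of 0] g by (simp add: zero_ereal_def)
  ultimately show ?thesis using f by auto
qed

lemma max_order_one: "max_order \<one> = 0"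
  using max_order_eqI[of \<one> 0] one_notin_max max_power_1 by (simp add: zero_ereal_def)

lemma max_order_zero: "max_order \<zero> = \<infinity>"
  by (intro max_order_infinite zero_in_max_power) simp

lemma max_order_x: "max_order x = 1"
proof -
  have "x \<in> max_power (Suc 0)" using x_in_max max_power_1 by simp
  moreover have "x \<notin> max_power (Suc (Suc 0))"
    using x_cancel_max_power[of \<one> "Suc 0"] one_notin_max max_power_1 by auto
  ultimately show ?thesis using max_order_eqI[of x "Suc 0"] by (simp add: one_ereal_def)
qed

lemma max_order_normalized: "max_order \<in> normalized_valuations R \<mm>"
proof -
  have nonneg: "0 \<le> max_order f" if "f \<in> carrier R" for f
    using le_max_order_iff[OF that, of 0] that by (simp add: zero_ereal_def)
  have ge1: "1 \<le> max_order f" if "f \<in> \<mm>" for f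
    using le_max_order_iff[OF Icarr[OF that], of "Suc 0"] that max_power_1 by (simp add: one_ereal_def)
  have "centered_valuation \<mm> R max_order"
  proof unfold_locales
    show "max_order \<in> carrier R \<rightarrow>\<^sub>E - {- \<infinity>}"
      using nonneg by (intro PiE_I) (auto simp: max_order_def)
    show "\<exists>f\<in>carrier R. \<exists>g\<in>carrier R. max_order f \<noteq> max_order g"
      using max_order_one max_order_zero by (intro bexI[of _ \<one>] bexI[of _ \<zero>]) auto
    show "min (max_order f) (max_order g) \<le> max_order (f \<oplus> g)" if fg: "f \<in> carrier R" "g \<in> carrier R" for f g
    proof -
      have "f \<oplus> g \<in> carrier R" using fg by simp
      then show ?thesis
      proof (cases rule: max_order_cases)
        case (finite n)
        then have "f \<notin> max_power (Suc n) \<or> g \<notin> max_power (Suc n)" using max_power_add by blast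
        then have "max_order f \<le> ereal (real n) \<or> max_order g \<le> ereal (real n)"
          using max_order_le_if_notin fg by blast
        then show ?thesis using finite(3) by (simp add: min_le_iff_disj)
      qed simp
    qed
    show "0 < max_order f" if "f \<in> \<mm>" for f
      using ge1[OF that] by (rule order.strict_trans2[rotated]) simp
  qed (use max_order_mult max_order_one max_order_zero nonneg in auto)
  moreover have "val_ideal max_order \<mm> = 1"
    unfolding val_ideal_def using ge1 max_order_x x_in_max by (intro Least_equality) force+
  ultimately show ?thesis by (simp add: normalized_valuations_def)
qed

text \<open>The order is the smallest normalized valuation, as \<open>\<mm>^n\<close> is spanned by products of
\<open>n\<close> elements of value at least \<open>1\<close>.\<close>

lemma max_order_le:
  assumes "centered_valuation \<mm> R \<nu>" "\<And>f. f \<in> \<mm> \<Longrightarrow> 1 \<le> \<nu> f" "f \<in> carrier R"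
  shows "max_order f \<le> \<nu> f"
proof -
  interpret v: centered_valuation \<mm> R \<nu> by fact
  have y_pow: "ereal (real n) \<le> \<nu> (y [^] n)" for n :: nat
  proof (induction n)
    case (Suc n)
    have "ereal (real n) + 1 \<le> \<nu> (y [^] n) + \<nu> y"
      using Suc assms(2)[OF y_in_max] by (rule add_mono)
    then show ?case by (simp add: v.val_mult one_ereal_def add.commute)
  qed (simp add: v.val_one zero_ereal_def)
  have "ereal (real n) \<le> \<nu> g" if "g \<in> max_power n" for n g
    using that
  proof (induction n arbitrary: g)
    case 0
    then show ?case using v.val_nonneg by (simp add: zero_ereal_def)
  next
    case (Suc n)
    obtain g1 h where g: "g1 \<in> max_power n" "h \<in> carrier R" "g = x \<otimes> g1 \<oplus> y [^] Suc n \<otimes> h"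
      using Suc.prems by (rule max_power_SucE)
    have g1: "g1 \<in> carrier R" using g(1) by (rule max_power_closed)
    have "1 + ereal (real n) \<le> \<nu> (x \<otimes> g1)"
      using add_mono[OF assms(2)[OF x_in_max] Suc.IH[OF g(1)]] g1 by (simp add: v.val_mult)
    moreover have "ereal (real (Suc n)) + 0 \<le> \<nu> (y [^] Suc n \<otimes> h)"
      using add_mono[OF y_pow[of "Suc n"] v.val_nonneg[OF g(2)]] g(2)
        v.val_mult[OF nat_pow_closed[OF y_closed, of "Suc n"] g(2)] by simp
    moreover have "min (\<nu> (x \<otimes> g1)) (\<nu> (y [^] Suc n \<otimes> h)) \<le> \<nu> g"
      unfolding g(3) using g1 g(2) by (intro v.val_add) auto
    ultimately show ?case by (auto simp: one_ereal_def min_le_iff_disj intro: order_trans)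
  qed
  then show ?thesis unfolding max_order_def using assms(3) by (auto intro: SUP_least)
qed

end

section \<open>Valuations below a common valuation\<close>

context valuation
begin

lemma val_minf: "f \<in> carrier R \<Longrightarrow> \<nu> f \<noteq> - \<infinity>"
  using val_funcset by auto

lemma val_minus: "f \<in> carrier R \<Longrightarrow> \<nu> (\<ominus> f) = \<nu> f"
proof -
  assume f: "f \<in> carrier R"
  have "\<nu> (\<ominus> \<one>) + \<nu> (\<ominus> \<one>) = 0"
    using val_mult[of "\<ominus> \<one>" "\<ominus> \<one>"] by (simp add: l_minus val_one)
  then have "\<nu> (\<ominus> \<one>) = 0" by (cases "\<nu> (\<ominus> \<one>)") (auto simp: zero_ereal_def)
  then show ?thesis using val_mult[of "\<ominus> \<one>" f] f by (simp add: l_minus)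
qed

lemma val_diff:
  "f \<in> carrier R \<Longrightarrow> g \<in> carrier R \<Longrightarrow> min (\<nu> f) (\<nu> g) \<le> \<nu> (f \<ominus> g)"
  using val_add[of f "\<ominus> g"] val_minus[of g] by (simp add: minus_eq)

lemma val_pow:
  fixes n :: nat
  assumes "f \<in> carrier R" "\<nu> f = 1"
  shows "\<nu> (f [^] n) = ereal (real n)"
  by (induction n) (use assms in \<open>auto simp: val_one val_mult one_ereal_def zero_ereal_def\<close>)

end

text \<open>A failure \<open>\<mu>\<^sub>2 f < \<mu>\<^sub>1 f\<close> is passed on to the quotient \<open>q\<close> of \<open>f\<close> by
\<open>\<phi>\<close>, and \<open>\<mu>\<^sub>2 q \<le> \<mu>\<^sub>2 f - 1\<close>, so it cannot be passed on forever.
The remainder \<open>r\<close> does not interfere, because its value exceeds \<open>\<mu>\<^sub>2 f\<close> for both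
valuations. This is clear if the value of \<open>r\<close> is at least \<open>N\<close>. Otherwise all three valuations agree at
\<open>r\<close>, and it suffices that \<open>\<mu>\<^sub>1 f \<le> \<mu>\<^sub>1 r\<close>.\<close>

lemma valuation_le_if_approx_division:
  fixes R (structure)
  assumes "valuation R \<mu>\<^sub>1" "valuation R \<mu>\<^sub>2" "valuation R \<nu>"
    and le: "\<And>f. f \<in> carrier R \<Longrightarrow> \<mu>\<^sub>1 f \<le> \<nu> f"
    and nonneg: "\<And>f. f \<in> carrier R \<Longrightarrow> 0 \<le> \<mu>\<^sub>2 f"
    and \<phi>: "\<phi> \<in> carrier R" "\<mu>\<^sub>1 \<phi> \<le> \<mu>\<^sub>2 \<phi>" "\<mu>\<^sub>1 \<phi> < \<nu> \<phi>" "1 \<le> \<mu>\<^sub>2 \<phi>"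
    and division: "\<And>f N. f \<in> carrier R \<Longrightarrow> \<exists>q\<in>carrier R. \<exists>r\<in>carrier R. f = q \<otimes> \<phi> \<oplus> r \<and>
      (ereal (real N) \<le> \<mu>\<^sub>1 r \<and> ereal (real N) \<le> \<mu>\<^sub>2 r \<or> \<mu>\<^sub>1 r = \<nu> r \<and> \<mu>\<^sub>2 r = \<nu> r)"
    and f: "f \<in> carrier R"
  shows "\<mu>\<^sub>1 f \<le> \<mu>\<^sub>2 f"
proof -
  interpret m1: valuation R \<mu>\<^sub>1 by fact
  interpret m2: valuation R \<mu>\<^sub>2 by fact
  interpret v: valuation R \<nu> by fact
  have "\<mu>\<^sub>1 f \<le> \<mu>\<^sub>2 f" if "f \<in> carrier R" "\<mu>\<^sub>2 f < ereal (real n)" for n f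
    using that
  proof (induction n arbitrary: f)
    case 0
    then show ?case using nonneg[of f] by (simp add: zero_ereal_def)
  next
    case (Suc n)
    show ?case
    proof (rule ccontr)
      assume "\<not> \<mu>\<^sub>1 f \<le> \<mu>\<^sub>2 f"
      then have less: "\<mu>\<^sub>2 f < \<mu>\<^sub>1 f" by simp
      obtain q r where q: "q \<in> carrier R" "r \<in> carrier R" "f = q \<otimes> \<phi> \<oplus> r"
        and r: "ereal (real (Suc n)) \<le> \<mu>\<^sub>1 r \<and> ereal (real (Suc n)) \<le> \<mu>\<^sub>2 r \<or> \<mu>\<^sub>1 r = \<nu> r \<and> \<mu>\<^sub>2 r = \<nu> r"
        using division[OF Suc.prems(1), of "Suc n"] by blast
      have qp: "q \<otimes> \<phi> \<in> carrier R" using q \<phi> by simp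
      have qp_eq: "q \<otimes> \<phi> = f \<ominus> r" unfolding q(3) using qp q(2) by algebra
      have r_eq: "r = f \<ominus> q \<otimes> \<phi>" unfolding q(3) using qp q(2) by algebra
      have m1qp: "min (\<mu>\<^sub>1 f) (\<mu>\<^sub>1 r) \<le> \<mu>\<^sub>1 (q \<otimes> \<phi>)"
        using m1.val_diff[OF Suc.prems(1) q(2)] qp_eq by simp
      have r_less: "\<mu>\<^sub>2 f < \<mu>\<^sub>1 r \<and> \<mu>\<^sub>2 f < \<mu>\<^sub>2 r"
        using r
      proof
        assume "ereal (real (Suc n)) \<le> \<mu>\<^sub>1 r \<and> ereal (real (Suc n)) \<le> \<mu>\<^sub>2 r"
        then show ?thesis using Suc.prems(2) by (meson less_le_trans)
      next
        assume eq: "\<mu>\<^sub>1 r = \<nu> r \<and> \<mu>\<^sub>2 r = \<nu> r"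
        \<comment> \<open>Otherwise \<open>r\<close> cancels against \<open>q \<phi>\<close>. But \<open>\<nu>\<close> exceeds \<open>\<mu>\<^sub>1\<close>
          strictly at \<open>q \<phi>\<close> while it agrees with \<open>\<mu>\<^sub>1\<close> at \<open>r\<close>, so no
          cancellation is possible for \<open>\<nu>\<close>.\<close>
        have "\<mu>\<^sub>1 f \<le> \<mu>\<^sub>1 r"
        proof (rule ccontr)
          assume "\<not> \<mu>\<^sub>1 f \<le> \<mu>\<^sub>1 r"
          then have lt: "\<mu>\<^sub>1 r < \<mu>\<^sub>1 f" by simp
          have "\<nu> r < \<nu> f" using lt eq le[OF Suc.prems(1)] by simp
          moreover have "\<nu> r < \<nu> (q \<otimes> \<phi>)"
          proof -
            have "\<mu>\<^sub>1 r \<le> \<mu>\<^sub>1 q + \<mu>\<^sub>1 \<phi>" using m1qp lt q(1) \<phi>(1) by (simp add: m1.val_mult)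
            moreover have "\<mu>\<^sub>1 r \<noteq> \<infinity>" using lt by auto
            moreover have "\<mu>\<^sub>1 r \<noteq> - \<infinity>" "\<mu>\<^sub>1 q \<noteq> - \<infinity>" "\<mu>\<^sub>1 \<phi> \<noteq> - \<infinity>" "\<nu> q \<noteq> - \<infinity>" "\<nu> \<phi> \<noteq> - \<infinity>"
              using q \<phi> m1.val_minf v.val_minf by auto
            ultimately have "\<mu>\<^sub>1 r < \<nu> q + \<nu> \<phi>"
              using le[OF q(1)] \<phi>(3)
              by (cases "\<mu>\<^sub>1 r"; cases "\<mu>\<^sub>1 q"; cases "\<mu>\<^sub>1 \<phi>"; cases "\<nu> q"; cases "\<nu> \<phi>") auto
            then show ?thesis using eq q(1) \<phi>(1) by (simp add: v.val_mult)
          qed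
          ultimately have "\<nu> r < min (\<nu> f) (\<nu> (q \<otimes> \<phi>))" by simp
          also have "\<dots> \<le> \<nu> r" using v.val_diff[OF Suc.prems(1) qp] r_eq by simp
          finally show False by simp
        qed
        then show ?thesis using less eq by simp
      qed
      have "\<mu>\<^sub>2 f < \<mu>\<^sub>1 (q \<otimes> \<phi>)" using m1qp r_less less by (simp add: min_le_iff_disj) (metis less_le_trans)
      then have 1: "\<mu>\<^sub>2 f < \<mu>\<^sub>1 q + \<mu>\<^sub>1 \<phi>" using q \<phi> by (simp add: m1.val_mult)
      have "min (\<mu>\<^sub>2 (q \<otimes> \<phi>)) (\<mu>\<^sub>2 r) \<le> \<mu>\<^sub>2 f" unfolding q(3) using qp q(2) by (rule m2.val_add)
      then have "\<mu>\<^sub>2 (q \<otimes> \<phi>) \<le> \<mu>\<^sub>2 f" using r_less by (auto simp: min_le_iff_disj)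
      then have 2: "\<mu>\<^sub>2 q + \<mu>\<^sub>2 \<phi> \<le> \<mu>\<^sub>2 f" using q \<phi> by (simp add: m2.val_mult)
      have "\<mu>\<^sub>2 q < ereal (real n)"
      proof -
        have "\<mu>\<^sub>2 q + 1 \<le> \<mu>\<^sub>2 q + \<mu>\<^sub>2 \<phi>" using \<phi>(4) by (intro add_left_mono)
        then have "\<mu>\<^sub>2 q + 1 < ereal (real (Suc n))" using 2 Suc.prems(2) by (meson le_less_trans)
        then show ?thesis by (cases "\<mu>\<^sub>2 q") (auto simp: one_ereal_def)
      qed
      then have "\<mu>\<^sub>1 q \<le> \<mu>\<^sub>2 q" using Suc.IH q(1) by blast
      then have "\<mu>\<^sub>1 q + \<mu>\<^sub>1 \<phi> \<le> \<mu>\<^sub>2 q + \<mu>\<^sub>2 \<phi>" using \<phi>(2) by (rule add_mono)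
      then show False using 1 2 by (meson le_less_trans less_le_trans less_irrefl)
    qed
  qed
  moreover have "\<exists>n. \<mu>\<^sub>2 f < ereal (real n)" if "\<mu>\<^sub>2 f \<noteq> \<infinity>"
    using that reals_Archimedean2 by (cases "\<mu>\<^sub>2 f") auto
  ultimately show ?thesis using f by (cases "\<mu>\<^sub>2 f = \<infinity>") auto
qed

context regular_parameters
begin

lemma pow_x_multiple_or_regular:
  assumes "f \<in> carrier R"
  shows "(\<exists>s\<in>carrier R. f = x [^] (N::nat) \<otimes> s) \<or>
    (\<exists>k::nat. \<exists>i g. regular_of_order i g \<and> f = x [^] k \<otimes> g)"
proof (induction N)
  case 0
  then show ?case using assms by (intro disjI1 bexI[of _ f]) auto
next
  case (Suc N)
  then show ?case
  proof
    assume "\<exists>s\<in>carrier R. f = x [^] N \<otimes> s"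
    then obtain s where s: "s \<in> carrier R" "f = x [^] N \<otimes> s" by blast
    show ?thesis
    proof (cases "x divides s")
      case True
      then obtain t where t: "t \<in> carrier R" "s = x \<otimes> t" by (auto simp: factor_def)
      then have "f = x [^] Suc N \<otimes> t" using s by (simp add: m_assoc)
      then show ?thesis using t by blast
    next
      case False
      then show ?thesis using s x_dvd_or_regular by blast
    qed
  qed blast
qed

text \<open>Weierstrass division truncated at \<open>x^N\<close>. The remainder \<open>x^N s\<close> of one stage is improved as
long as \<open>s\<close> is regular of order \<open>i \<ge> n\<close>: a multiple of \<open>\<phi>\<close> then cancels its
term in \<open>y^i\<close> and leaves a multiple of \<open>x\<close>.\<close>

lemma approx_division:
  assumes \<phi>: "regular_of_order n \<phi>" and f: "f \<in> carrier R"
  shows "\<exists>q\<in>carrier R. \<exists>r\<in>carrier R. f = q \<otimes> \<phi> \<oplus> r \<and>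
    ((\<exists>s\<in>carrier R. r = x [^] (N::nat) \<otimes> s) \<or>
     (\<exists>k::nat. \<exists>i<n. \<exists>g. regular_of_order i g \<and> r = x [^] k \<otimes> g))"
proof (induction N)
  case 0
  have "\<phi> \<in> carrier R" using \<phi> by (rule regular_of_order_closed)
  then show ?case using f by (intro bexI[of _ \<zero>] bexI[of _ f]) auto
next
  case (Suc N)
  have \<phi>c: "\<phi> \<in> carrier R" using \<phi> by (rule regular_of_order_closed)
  obtain q r where q: "q \<in> carrier R" "r \<in> carrier R" "f = q \<otimes> \<phi> \<oplus> r"
    and r: "(\<exists>s\<in>carrier R. r = x [^] N \<otimes> s) \<or>
      (\<exists>k::nat. \<exists>i<n. \<exists>g. regular_of_order i g \<and> r = x [^] k \<otimes> g)"
    using Suc by blast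
  from r show ?case
  proof
    assume "\<exists>k::nat. \<exists>i<n. \<exists>g. regular_of_order i g \<and> r = x [^] k \<otimes> g"
    then show ?thesis using q by blast
  next
    assume "\<exists>s\<in>carrier R. r = x [^] N \<otimes> s"
    then obtain s where s: "s \<in> carrier R" "r = x [^] N \<otimes> s" by blast
    consider "x divides s" | i where "i < n" "regular_of_order i s" | i where "n \<le> i" "regular_of_order i s"
      using x_dvd_or_regular[OF s(1)] not_le by blast
    then show ?thesis
    proof cases
      case 1
      then obtain t where t: "t \<in> carrier R" "s = x \<otimes> t" by (auto simp: factor_def)
      then have "r = x [^] Suc N \<otimes> t" using s by (simp add: m_assoc)
      then show ?thesis using t q by blast
    next
      case 2
      then show ?thesis using q s by blast
    next
      case 3
      obtain u c where u: "u \<in> Units R" "u \<in> carrier R" "c \<in> carrier R" "s = u \<otimes> y [^] i \<oplus> x \<otimes> c"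
        using 3(2) by (rule regular_of_orderE)
      obtain v d where v: "v \<in> Units R" "v \<in> carrier R" "d \<in> carrier R" "\<phi> = v \<otimes> y [^] n \<oplus> x \<otimes> d"
        using \<phi> by (rule regular_of_orderE)
      define w where "w = u \<otimes> inv v \<otimes> y [^] (i - n)"
      have w: "w \<in> carrier R" unfolding w_def using u v by simp
      have "w \<otimes> (v \<otimes> y [^] n) = u \<otimes> (inv v \<otimes> v) \<otimes> (y [^] (i - n) \<otimes> y [^] n)"
        unfolding w_def
        using u(2) v(2) Units_inv_closed[OF v(1)] nat_pow_closed[OF y_closed, of n]
          nat_pow_closed[OF y_closed, of "i - n"] by algebra
      then have wv: "w \<otimes> (v \<otimes> y [^] n) = u \<otimes> y [^] i"
        using u(2) v(1) 3(1) by (simp add: nat_pow_mult)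
      have "w \<otimes> \<phi> \<oplus> x \<otimes> (c \<ominus> w \<otimes> d) = w \<otimes> (v \<otimes> y [^] n) \<oplus> x \<otimes> c"
        unfolding v(4) using w v(2,3) u(3) x_closed nat_pow_closed[OF y_closed, of n] by algebra
      then have s_eq: "s = w \<otimes> \<phi> \<oplus> x \<otimes> (c \<ominus> w \<otimes> d)" using wv u(4) by simp
      have "f = (q \<oplus> x [^] N \<otimes> w) \<otimes> \<phi> \<oplus> x [^] Suc N \<otimes> (c \<ominus> w \<otimes> d)"
        unfolding q(3) s(2) s_eq nat_pow_Suc
        using q(1) w \<phi>c x_closed nat_pow_closed[OF x_closed, of N] u(3) v(3) by algebra
      moreover have "q \<oplus> x [^] N \<otimes> w \<in> carrier R" "c \<ominus> w \<otimes> d \<in> carrier R"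
        using q w u v by auto
      moreover from this have "x [^] Suc N \<otimes> (c \<ominus> w \<otimes> d) \<in> carrier R" by simp
      ultimately show ?thesis by blast
    qed
  qed
qed

text \<open>Every element is a power of \<open>x\<close> times a regular element, or divisible by every power of
\<open>x\<close>. As the three valuations give \<open>x\<close> the value \<open>1\<close>, they coincide once they agree at
all regular elements. Otherwise let \<open>\<phi>\<close> be regular of least order \<open>n\<close> with a disagreement,
and divide by \<open>\<phi>\<close>.\<close>

lemma valuations_below_comparable:
  assumes v: "centered_valuation \<mm> R \<mu>\<^sub>1" "centered_valuation \<mm> R \<mu>\<^sub>2" "centered_valuation \<mm> R \<nu>"
    and ge1: "\<And>f. f \<in> \<mm> \<Longrightarrow> 1 \<le> \<mu>\<^sub>1 f" "\<And>f. f \<in> \<mm> \<Longrightarrow> 1 \<le> \<mu>\<^sub>2 f"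
    and le: "\<And>f. f \<in> carrier R \<Longrightarrow> \<mu>\<^sub>1 f \<le> \<nu> f" "\<And>f. f \<in> carrier R \<Longrightarrow> \<mu>\<^sub>2 f \<le> \<nu> f"
    and \<nu>x: "\<nu> x = 1"
  shows "(\<forall>f\<in>carrier R. \<mu>\<^sub>1 f \<le> \<mu>\<^sub>2 f) \<or> (\<forall>f\<in>carrier R. \<mu>\<^sub>2 f \<le> \<mu>\<^sub>1 f)"
proof -
  interpret m1: centered_valuation \<mm> R \<mu>\<^sub>1 by fact
  interpret m2: centered_valuation \<mm> R \<mu>\<^sub>2 by fact
  interpret v: centered_valuation \<mm> R \<nu> by fact
  have x_val: "\<mu>\<^sub>1 x = 1" "\<mu>\<^sub>2 x = 1"
    using ge1 le \<nu>x x_in_max x_closed by (metis antisym)+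
  have pow_x: "\<mu>\<^sub>1 (x [^] k) = ereal (real k)" "\<mu>\<^sub>2 (x [^] k) = ereal (real k)" "\<nu> (x [^] k) = ereal (real k)"
    for k :: nat
    using x_val \<nu>x by (auto intro: m1.val_pow m2.val_pow v.val_pow)
  have pow_x_mult: "\<mu>\<^sub>1 (x [^] k \<otimes> g) = ereal (real k) + \<mu>\<^sub>1 g"
    "\<mu>\<^sub>2 (x [^] k \<otimes> g) = ereal (real k) + \<mu>\<^sub>2 g" "\<nu> (x [^] k \<otimes> g) = ereal (real k) + \<nu> g"
    if "g \<in> carrier R" for k :: nat and g
    using that by (auto simp: m1.val_mult m2.val_mult v.val_mult pow_x)
  have pow_x_ge: "ereal (real k) \<le> \<mu>\<^sub>1 (x [^] k \<otimes> g)" "ereal (real k) \<le> \<mu>\<^sub>2 (x [^] k \<otimes> g)"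
    if "g \<in> carrier R" for k :: nat and g
    using that m1.val_nonneg m2.val_nonneg by (auto simp: pow_x_mult add_increasing2)
  show ?thesis
  proof (cases "\<exists>i \<phi>. regular_of_order i \<phi> \<and> (\<mu>\<^sub>1 \<phi> \<noteq> \<nu> \<phi> \<or> \<mu>\<^sub>2 \<phi> \<noteq> \<nu> \<phi>)")
    case True
    define n where "n = (LEAST i. \<exists>\<phi>. regular_of_order i \<phi> \<and> (\<mu>\<^sub>1 \<phi> \<noteq> \<nu> \<phi> \<or> \<mu>\<^sub>2 \<phi> \<noteq> \<nu> \<phi>))"
    obtain \<phi> where \<phi>: "regular_of_order n \<phi>" "\<mu>\<^sub>1 \<phi> \<noteq> \<nu> \<phi> \<or> \<mu>\<^sub>2 \<phi> \<noteq> \<nu> \<phi>"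
      using LeastI_ex[OF True] unfolding n_def by blast
    have lower: "\<mu>\<^sub>1 g = \<nu> g" "\<mu>\<^sub>2 g = \<nu> g" if "i < n" "regular_of_order i g" for i g
      using not_less_Least[OF that(1)[unfolded n_def]] that(2) by blast+
    have \<phi>c: "\<phi> \<in> carrier R" using \<phi>(1) by (rule regular_of_order_closed)
    have "\<phi> \<in> \<mm>"
    proof (rule ccontr)
      assume "\<phi> \<notin> \<mm>"
      then have u: "\<phi> \<in> Units R" using unit_if_notin_max \<phi>c by blast
      then have "\<nu> \<phi> + \<nu> (inv \<phi>) = 0" using v.val_mult[of \<phi> "inv \<phi>"] by (simp add: v.val_one \<phi>c)
      moreover have "0 \<le> \<nu> (inv \<phi>)" using u by (intro v.val_nonneg) simp
      moreover have "0 \<le> \<nu> \<phi>" using \<phi>c by (rule v.val_nonneg)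
      ultimately have "\<nu> \<phi> = 0" by (simp add: add_nonneg_eq_0_iff)
      then have "\<mu>\<^sub>1 \<phi> = \<nu> \<phi>" "\<mu>\<^sub>2 \<phi> = \<nu> \<phi>"
        using m1.val_nonneg[OF \<phi>c] m2.val_nonneg[OF \<phi>c] le[OF \<phi>c] by auto
      then show False using \<phi>(2) by blast
    qed
    then have ge: "1 \<le> \<mu>\<^sub>1 \<phi>" "1 \<le> \<mu>\<^sub>2 \<phi>" using ge1 by auto
    have division: "\<exists>q\<in>carrier R. \<exists>r\<in>carrier R. f = q \<otimes> \<phi> \<oplus> r \<and>
      (ereal (real N) \<le> \<mu>\<^sub>1 r \<and> ereal (real N) \<le> \<mu>\<^sub>2 r \<or> \<mu>\<^sub>1 r = \<nu> r \<and> \<mu>\<^sub>2 r = \<nu> r)"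
      if f: "f \<in> carrier R" for f N
    proof -
      obtain q r where q: "q \<in> carrier R" "r \<in> carrier R" "f = q \<otimes> \<phi> \<oplus> r"
        and r: "(\<exists>s\<in>carrier R. r = x [^] N \<otimes> s) \<or>
          (\<exists>k::nat. \<exists>i<n. \<exists>g. regular_of_order i g \<and> r = x [^] k \<otimes> g)"
        using approx_division[OF \<phi>(1) f, of N] by blast
      from r have "ereal (real N) \<le> \<mu>\<^sub>1 r \<and> ereal (real N) \<le> \<mu>\<^sub>2 r \<or> \<mu>\<^sub>1 r = \<nu> r \<and> \<mu>\<^sub>2 r = \<nu> r"
        using pow_x_ge lower regular_of_order_closed pow_x_mult by metis
      then show ?thesis using q by blast
    qed
    show ?thesis
    proof (cases "\<mu>\<^sub>1 \<phi> \<le> \<mu>\<^sub>2 \<phi>")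
      case True
      then have "\<mu>\<^sub>1 \<phi> < \<nu> \<phi>" using \<phi>(2) le[OF \<phi>c] by (metis antisym le_neq_trans)
      then have "\<mu>\<^sub>1 f \<le> \<mu>\<^sub>2 f" if "f \<in> carrier R" for f
        using valuation_le_if_approx_division[of R \<mu>\<^sub>1 \<mu>\<^sub>2 \<nu> \<phi> f, OF m1.valuation_axioms
            m2.valuation_axioms v.valuation_axioms le(1) m2.val_nonneg \<phi>c True _ ge(2) division that]
        by blast
      then show ?thesis by blast
    next
      case False
      then have lt: "\<mu>\<^sub>2 \<phi> \<le> \<mu>\<^sub>1 \<phi>" "\<mu>\<^sub>2 \<phi> < \<nu> \<phi>" using le[OF \<phi>c] by auto
      have division':  "\<exists>q\<in>carrier R. \<exists>r\<in>carrier R. f = q \<otimes> \<phi> \<oplus> r \<and>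
        (ereal (real N) \<le> \<mu>\<^sub>2 r \<and> ereal (real N) \<le> \<mu>\<^sub>1 r \<or> \<mu>\<^sub>2 r = \<nu> r \<and> \<mu>\<^sub>1 r = \<nu> r)"
        if "f \<in> carrier R" for f N
        using division[OF that, of N] by blast
      have "\<mu>\<^sub>2 f \<le> \<mu>\<^sub>1 f" if "f \<in> carrier R" for f
        using valuation_le_if_approx_division[of R \<mu>\<^sub>2 \<mu>\<^sub>1 \<nu> \<phi> f, OF m2.valuation_axioms
            m1.valuation_axioms v.valuation_axioms le(2) m1.val_nonneg \<phi>c lt ge(1) division' that]
        by blast
      then show ?thesis by blast
    qed
  next
    case False
    have "\<mu>\<^sub>1 f \<le> \<mu>\<^sub>2 f" if f: "f \<in> carrier R" for f
    proof (cases "\<exists>k::nat. \<exists>i g. regular_of_order i g \<and> f = x [^] k \<otimes> g")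
      case True
      then obtain k :: nat and i g where g: "regular_of_order i g" "f = x [^] k \<otimes> g" by blast
      then show ?thesis
        using False pow_x_mult regular_of_order_closed by (metis order_refl)
    next
      case no: False
      have "ereal (real N) \<le> \<mu>\<^sub>2 f" for N
        using pow_x_multiple_or_regular[OF f, of N] no pow_x_ge by blast
      then have "\<mu>\<^sub>2 f = \<infinity>"
        by (metis ereal_top ereal_less_eq(3) order_trans real_arch_simple)
      then show ?thesis by simp
    qed
    then show ?thesis by blast
  qed
qed

end

section \<open>Infima of normalized valuations\<close>

lemma normalized_valuationsD:
  assumes "\<nu> \<in> normalized_valuations R \<mm>"
  shows "centered_valuation \<mm> R \<nu>" "\<And>f. f \<in> \<mm> \<Longrightarrow> 1 \<le> \<nu> f" "\<exists>z\<in>\<mm>. \<nu> z = 1"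
proof -
  show c: "centered_valuation \<mm> R \<nu>" using assms by (simp add: normalized_valuations_def)
  have "val_ideal \<nu> \<mm> = 1" using assms by (simp add: normalized_valuations_def)
  then show "\<And>f. f \<in> \<mm> \<Longrightarrow> 1 \<le> \<nu> f" "\<exists>z\<in>\<mm>. \<nu> z = 1"
    using centered_valuation.val_ideal_attained[OF c] by auto
qed

lemma (in two_generated_local_ring) swap_generators: "two_generated_local_ring \<mm> R y x"
proof unfold_locales
  have sub: "{p \<otimes> a \<oplus> q \<otimes> b | a b. a \<in> carrier R \<and> b \<in> carrier R}
      \<subseteq> {q \<otimes> a \<oplus> p \<otimes> b | a b. a \<in> carrier R \<and> b \<in> carrier R}"
    if "p \<in> carrier R" "q \<in> carrier R" for p q
  proof
    fix f assume "f \<in> {p \<otimes> a \<oplus> q \<otimes> b | a b. a \<in> carrier R \<and> b \<in> carrier R}"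
    then obtain a b where ab: "a \<in> carrier R" "b \<in> carrier R" "f = p \<otimes> a \<oplus> q \<otimes> b" by blast
    then have "f = q \<otimes> b \<oplus> p \<otimes> a" using that by (simp add: a_comm)
    then show "f \<in> {q \<otimes> a \<oplus> p \<otimes> b | a b. a \<in> carrier R \<and> b \<in> carrier R}" using ab by blast
  qed
  show "\<mm> = {y \<otimes> a \<oplus> x \<otimes> b | a b. a \<in> carrier R \<and> b \<in> carrier R}"
    unfolding max_eq by (intro equalityI sub x_closed y_closed)
qed auto

lemma (in two_generated_local_ring) exchange_generator:
  assumes "u \<in> Units R" "c \<in> carrier R"
  shows "two_generated_local_ring \<mm> R (x \<otimes> u \<oplus> y \<otimes> c) y"
proof unfold_locales
  have uc: "u \<in> carrier R" "inv u \<in> carrier R" using assms by auto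
  show "x \<otimes> u \<oplus> y \<otimes> c \<in> carrier R" using uc assms by simp
  show "\<mm> = {(x \<otimes> u \<oplus> y \<otimes> c) \<otimes> a \<oplus> y \<otimes> b | a b. a \<in> carrier R \<and> b \<in> carrier R}"
  proof
    show "{(x \<otimes> u \<oplus> y \<otimes> c) \<otimes> a \<oplus> y \<otimes> b | a b. a \<in> carrier R \<and> b \<in> carrier R} \<subseteq> \<mm>"
      using x_in_max y_in_max uc assms by (auto intro!: a_closed I_r_closed)
    show "\<mm> \<subseteq> {(x \<otimes> u \<oplus> y \<otimes> c) \<otimes> a \<oplus> y \<otimes> b | a b. a \<in> carrier R \<and> b \<in> carrier R}"
    proof
      fix f assume "f \<in> \<mm>"
      then obtain a b where ab: "a \<in> carrier R" "b \<in> carrier R" "f = x \<otimes> a \<oplus> y \<otimes> b"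
        unfolding max_eq by blast
      have "(x \<otimes> u \<oplus> y \<otimes> c) \<otimes> (inv u \<otimes> a) \<oplus> y \<otimes> (b \<ominus> c \<otimes> (inv u \<otimes> a))
          = x \<otimes> ((u \<otimes> inv u) \<otimes> a) \<oplus> y \<otimes> b"
        using ab(1,2) uc assms(2) x_closed y_closed by algebra
      also have "\<dots> = f" using assms(1) ab by simp
      finally have "f = (x \<otimes> u \<oplus> y \<otimes> c) \<otimes> (inv u \<otimes> a) \<oplus> y \<otimes> (b \<ominus> c \<otimes> (inv u \<otimes> a))" by (rule sym)
      moreover have "inv u \<otimes> a \<in> carrier R" "b \<ominus> c \<otimes> (inv u \<otimes> a) \<in> carrier R"
        using ab uc assms(2) by auto
      ultimately show "f \<in> {(x \<otimes> u \<oplus> y \<otimes> c) \<otimes> a \<oplus> y \<otimes> b | a b. a \<in> carrier R \<and> b \<in> carrier R}"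
        by blast
    qed
  qed
qed auto

text \<open>An element of minimal value is not in \<open>\<mm>^2\<close>, so it can replace one of the two generators.\<close>

lemma (in two_generated_local_ring) generator_of_minimal_value:
  assumes \<nu>: "\<nu> \<in> normalized_valuations R \<mm>" and z: "z \<in> \<mm>" "\<nu> z = 1"
  shows "\<exists>w. two_generated_local_ring \<mm> R z w"
proof -
  interpret v: centered_valuation \<mm> R \<nu> using \<nu> by (rule normalized_valuationsD)
  note ge1 = normalized_valuationsD(2)[OF \<nu>]
  obtain a b where ab: "a \<in> carrier R" "b \<in> carrier R" "z = x \<otimes> a \<oplus> y \<otimes> b"
    using z(1) unfolding max_eq by blast
  consider "a \<in> Units R" | "b \<in> Units R" | "a \<in> \<mm>" "b \<in> \<mm>"
    using unit_if_notin_max ab by blast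
  then show ?thesis
  proof cases
    case 1
    then show ?thesis using exchange_generator[OF 1 ab(2)] ab(3) by blast
  next
    case 2
    interpret s: two_generated_local_ring \<mm> R y x by (rule swap_generators)
    show ?thesis using s.exchange_generator[OF 2 ab(1)] ab by (auto simp: a_comm)
  next
    case 3
    have "1 + 1 \<le> \<nu> (x \<otimes> a)" "1 + 1 \<le> \<nu> (y \<otimes> b)"
      unfolding v.val_mult[OF x_closed ab(1)] v.val_mult[OF y_closed ab(2)]
      using 3 ge1 x_in_max y_in_max by (auto intro: add_mono simp del: one_add_one)
    then have "1 + 1 \<le> min (\<nu> (x \<otimes> a)) (\<nu> (y \<otimes> b))" by simp
    also have "\<dots> \<le> \<nu> z" unfolding ab(3) using ab by (intro v.val_add) auto
    finally show ?thesis using z(2) by (simp add: one_ereal_def)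
  qed
qed

lemma (in regular_local_ring) regular_parametersI:
  assumes "krull_dim R = 2" "two_generated_local_ring \<mm> R x y"
  shows "regular_parameters \<mm> R x y"
  by (intro regular_parameters.intro regular_parameters_axioms.intro assms
      two_generated_domain(1) two_generated_domain(3,4)[OF assms])

lemma (in regular_local_ring) normalized_valuations_below_comparable:
  assumes dim: "krull_dim R = 2"
    and \<nu>: "\<nu> \<in> normalized_valuations R \<mm>"
    and \<mu>: "\<mu>\<^sub>1 \<in> normalized_valuations R \<mm>" "\<mu>\<^sub>2 \<in> normalized_valuations R \<mm>"
    and le: "\<forall>f\<in>carrier R. \<mu>\<^sub>1 f \<le> \<nu> f" "\<forall>f\<in>carrier R. \<mu>\<^sub>2 f \<le> \<nu> f"
  shows "(\<forall>f\<in>carrier R. \<mu>\<^sub>1 f \<le> \<mu>\<^sub>2 f) \<or> (\<forall>f\<in>carrier R. \<mu>\<^sub>2 f \<le> \<mu>\<^sub>1 f)"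
proof -
  obtain x0 y0 where "two_generated_local_ring \<mm> R x0 y0" using two_generated_domain(2)[OF dim] by blast
  moreover obtain x where x: "x \<in> \<mm>" "\<nu> x = 1" using normalized_valuationsD(3)[OF \<nu>] by blast
  ultimately obtain y where "two_generated_local_ring \<mm> R x y"
    using two_generated_local_ring.generator_of_minimal_value[OF _ \<nu> x] by blast
  then interpret regular_parameters \<mm> R x y by (rule regular_parametersI[OF dim])
  show ?thesis
    by (rule valuations_below_comparable[OF normalized_valuationsD(1)[OF \<mu>(1)]
          normalized_valuationsD(1)[OF \<mu>(2)] normalized_valuationsD(1)[OF \<nu>]])
      (use le x normalized_valuationsD(2)[OF \<mu>(1)] normalized_valuationsD(2)[OF \<mu>(2)] in auto)
qed

text \<open>A supremum of valuations inherits the defining inequalities and equations as soon as any two values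
can be approximated by one and the same valuation, which holds in a chain. The bound
\<open>\<sigma>\<close> provides an element of \<open>\<mm>\<close> at which the supremum is exactly \<open>1\<close>.\<close>

lemma chain_Sup_normalized:
  fixes R (structure)
  assumes L: "L \<subseteq> normalized_valuations R \<mm>" "L \<noteq> {}"
    and chain: "\<And>\<mu> \<mu>'. \<mu> \<in> L \<Longrightarrow> \<mu>' \<in> L \<Longrightarrow>
      (\<forall>f\<in>carrier R. \<mu> f \<le> \<mu>' f) \<or> (\<forall>f\<in>carrier R. \<mu>' f \<le> \<mu> f)"
    and bound: "\<sigma> \<in> normalized_valuations R \<mm>" "\<And>\<mu> f. \<mu> \<in> L \<Longrightarrow> f \<in> carrier R \<Longrightarrow> \<mu> f \<le> \<sigma> f"
  shows "restrict (\<lambda>f. SUP \<mu>\<in>L. \<mu> f) (carrier R) \<in> normalized_valuations R \<mm>"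
proof -
  define s where "s = restrict (\<lambda>f. SUP \<mu>\<in>L. \<mu> f) (carrier R)"
  have s_eq: "s f = (SUP \<mu>\<in>L. \<mu> f)" if "f \<in> carrier R" for f using that by (simp add: s_def)
  interpret v: centered_valuation \<mm> R \<sigma> by (rule normalized_valuationsD(1)[OF bound(1)])
  have cent: "centered_valuation \<mm> R \<mu>" if "\<mu> \<in> L" for \<mu> using that L normalized_valuationsD(1) by blast
  note val = centered_valuation.axioms(2)[OF cent]
  obtain \<mu>0 where \<mu>0: "\<mu>0 \<in> L" using L(2) by blast
  have upper: "\<mu> f \<le> s f" if "\<mu> \<in> L" "f \<in> carrier R" for \<mu> f
    unfolding s_eq[OF that(2)] using that(1) by (rule SUP_upper)
  have nonneg: "0 \<le> \<mu> f" if "\<mu> \<in> L" "f \<in> carrier R" for \<mu> f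
    using centered_valuation.val_nonneg[OF cent[OF that(1)] that(2)] .
  have s_nonneg: "0 \<le> s f" if "f \<in> carrier R" for f
    using nonneg[OF \<mu>0 that] upper[OF \<mu>0 that] by (rule order_trans)
  have s_mult: "s (f \<otimes> g) = s f + s g" if fg: "f \<in> carrier R" "g \<in> carrier R" for f g
  proof -
    have "s (f \<otimes> g) = (SUP \<mu>\<in>L. \<mu> f + \<mu> g)"
      using fg valuation.val_mult[OF val] by (simp add: s_eq)
    also have "\<dots> = s f + s g"
      unfolding s_eq[OF fg(1)] s_eq[OF fg(2)]
    proof (rule SUP_ereal_add_directed)
      fix \<mu> \<mu>' assume m: "\<mu> \<in> L" "\<mu>' \<in> L"
      from chain[OF m] show "\<exists>k\<in>L. \<mu> f + \<mu>' g \<le> k f + k g"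
      proof
        assume "\<forall>f\<in>carrier R. \<mu> f \<le> \<mu>' f"
        then show ?thesis using m fg by (intro bexI[of _ \<mu>'] add_mono) auto
      next
        assume "\<forall>f\<in>carrier R. \<mu>' f \<le> \<mu> f"
        then show ?thesis using m fg by (intro bexI[of _ \<mu>] add_mono) auto
      qed
    qed (use nonneg fg in auto)
    finally show ?thesis .
  qed
  have s_add: "min (s f) (s g) \<le> s (f \<oplus> g)" if fg: "f \<in> carrier R" "g \<in> carrier R" for f g
  proof (rule ccontr)
    assume "\<not> ?thesis"
    then have "s (f \<oplus> g) < min (s f) (s g)" by (simp only: not_le)
    then have "s (f \<oplus> g) < s f" "s (f \<oplus> g) < s g" by auto
    then obtain \<mu> \<mu>' where m: "\<mu> \<in> L" "s (f \<oplus> g) < \<mu> f" "\<mu>' \<in> L" "s (f \<oplus> g) < \<mu>' g"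
      unfolding s_eq[OF fg(1)] s_eq[OF fg(2)] less_SUP_iff by blast
    obtain k where k: "k \<in> L" "s (f \<oplus> g) < k f" "s (f \<oplus> g) < k g"
      using chain[OF m(1,3)] m fg by (meson less_le_trans)
    have "s (f \<oplus> g) < min (k f) (k g)" using k by simp
    also have "\<dots> \<le> k (f \<oplus> g)" using valuation.val_add[OF val[OF k(1)] fg] .
    also have "\<dots> \<le> s (f \<oplus> g)" using upper[OF k(1)] fg by simp
    finally show False by simp
  qed
  have s_one: "s \<one> = 0"
    unfolding s_eq[OF v.one_closed] using L(2) valuation.val_one[OF val] by (rule SUP_eq_const)
  have s_zero: "s \<zero> = \<infinity>"
    unfolding s_eq[OF v.add.one_closed] using L(2) valuation.val_zero[OF val] by (rule SUP_eq_const)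
  have ge1: "1 \<le> s f" if "f \<in> \<mm>" for f
    using normalized_valuationsD(2)[of \<mu>0 R \<mm> f] \<mu>0 L(1) that upper[OF \<mu>0 v.Icarr[OF that]]
    by (meson order_trans subsetD)
  have "centered_valuation \<mm> R s"
  proof unfold_locales
    show "s \<in> carrier R \<rightarrow>\<^sub>E - {- \<infinity>}"
      using s_nonneg by (intro PiE_I) (auto simp: s_def)
    show "\<exists>f\<in>carrier R. \<exists>g\<in>carrier R. s f \<noteq> s g"
      using s_one s_zero by (intro bexI[of _ \<one>] bexI[of _ \<zero>]) auto
    show "0 < s f" if "f \<in> \<mm>" for f
      using ge1[OF that] by (rule order.strict_trans2[rotated]) simp
  qed (use s_mult s_add s_one s_zero s_nonneg in auto)
  moreover have "val_ideal s \<mm> = 1"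
  proof -
    obtain z where z: "z \<in> \<mm>" "\<sigma> z = 1" using normalized_valuationsD(3)[OF bound(1)] by blast
    have zc: "z \<in> carrier R" using z(1) by (rule v.Icarr)
    have "s z \<le> 1" unfolding s_eq[OF zc] using bound(2)[OF _ zc] z(2) by (auto intro: SUP_least)
    then have "s z = 1" using ge1[OF z(1)] by (rule antisym)
    then show ?thesis
      unfolding val_ideal_def using z(1) ge1 by (intro Least_equality) force+
  qed
  ultimately show ?thesis by (simp add: normalized_valuations_def s_def)
qed

theorem theorem1p1:
  fixes R :: "('a, 'b) ring_scheme" and \<mm> :: "'a set" and S :: "('a \<Rightarrow> ereal) set"
  assumes "regular_local_ring \<mm> R"
    and "krull_dim R = 2"
    and "S \<subseteq> normalized_valuations R \<mm>"
    and "S \<noteq> {}"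
  shows "\<exists>\<nu> \<in> normalized_valuations R \<mm>. is_glb (valuation_order R \<mm>) \<nu> S"
proof -
  interpret regular_local_ring \<mm> R by fact
  note dim = assms(2)
  define L where
    "L = {\<mu> \<in> normalized_valuations R \<mm>. \<forall>\<sigma>\<in>S. \<forall>f\<in>carrier R. \<mu> f \<le> \<sigma> f}"
  have Lower_eq: "Lower (valuation_order R \<mm>) S = L"
    using assms(3) by (auto simp: Lower_def valuation_order_def L_def)
  obtain \<sigma> where \<sigma>: "\<sigma> \<in> S" "\<sigma> \<in> normalized_valuations R \<mm>" using assms(3,4) by blast
  obtain x y where xy: "two_generated_local_ring \<mm> R x y" using two_generated_domain(2)[OF dim] by blast
  then interpret P: regular_parameters \<mm> R x y by (rule regular_parametersI[OF dim])
  have "P.max_order f \<le> \<sigma> f" if "\<sigma> \<in> S" "f \<in> carrier R" for \<sigma> f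
  proof (rule P.max_order_le)
    have \<sigma>: "\<sigma> \<in> normalized_valuations R \<mm>" using that(1) assms(3) by blast
    show "centered_valuation \<mm> R \<sigma>" "\<And>f. f \<in> \<mm> \<Longrightarrow> 1 \<le> \<sigma> f"
      using normalized_valuationsD(1,2)[OF \<sigma>] by auto
  qed (rule that)
  then have "P.max_order \<in> L" unfolding L_def using P.max_order_normalized by blast
  then have "L \<noteq> {}" by blast
  define \<nu> where "\<nu> = restrict (\<lambda>f. SUP \<mu>\<in>L. \<mu> f) (carrier R)"
  have norm: "\<nu> \<in> normalized_valuations R \<mm>"
    unfolding \<nu>_def
  proof (rule chain_Sup_normalized[where \<sigma> = \<sigma>])
    show "(\<forall>f\<in>carrier R. \<mu> f \<le> \<mu>' f) \<or> (\<forall>f\<in>carrier R. \<mu>' f \<le> \<mu> f)" if "\<mu> \<in> L" "\<mu>' \<in> L" for \<mu> \<mu>'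
      using that \<sigma>(1) by (intro normalized_valuations_below_comparable[OF dim \<sigma>(2)]) (auto simp: L_def)
  qed (use \<sigma> \<open>L \<noteq> {}\<close> in \<open>auto simp: L_def\<close>)
  have "\<nu> \<in> L"
    using norm by (auto simp: L_def \<nu>_def intro!: SUP_least)
  moreover have "\<mu> f \<le> \<nu> f" if "\<mu> \<in> L" "f \<in> carrier R" for \<mu> f
    using that by (auto simp: \<nu>_def intro!: SUP_upper)
  ultimately have "is_glb (valuation_order R \<mm>) \<nu> S"
    unfolding Lower_eq greatest_def by (auto simp: valuation_order_def L_def)
  then show ?thesis using norm by blast
qed

end
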